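(* Consider interactive proof systems whose verifiers are probabilistic finite automata with some finite number of one-way heads on the input tape that use at most a constant number of random bits, independent of the input. For each of the four variants — strong or weak definition, and one-way or two-way communication with the prover — the class of languages having such an interactive proof system (with some error $\varepsilon<\frac12$) is exactly $\bigcup_{k\ge1}\mathsf{1NFA}(k)$.
   Context: A probabilistic finite automaton with $k$ one-way heads has finitely many states, $k$ heads on a read-only tape containing the input between end-markers that never move left, access to private fair coins, and a communication cell over a finite alphabet with a null symbol; the prover replies with symbols depending on the input and the communication history, or, in one-way communication, the prover's messages form a fixed sequence depending only on the input. Strong system with error $\varepsilon$: some prover makes every $x\in L$ accepted with probability $\ge1-\varepsilon$, and for $x\notin L$ every prover leads to rejection with probability $\ge1-\varepsilon$. Weak system: same, but for $x\notin L$ every prover leads to acceptance with probability $\le\varepsilon$. $\mathsf{1NFA}(k)$ is the class of languages recognized by nondeterministic finite automata with $k$ one-way heads. *)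

theory Defs
  imports "HOL-Probability.Probability"
begin

section \<open>Input tapes\<close>

datatype 'a tape_symbol = Left_End | Letter 'a | Right_End

text \<open>The tape holds the input at positions \<open>1, \<dots>, n\<close> between end-markers at
  positions \<open>0\<close> and \<open>n + 1\<close>. Head movements are lists over \<open>{0, 1}\<close> (stay, move right);
  the well-formedness conditions below keep every head within positions \<open>0, \<dots>, n + 1\<close>.\<close>

definition tape :: "'a list \<Rightarrow> nat \<Rightarrow> 'a tape_symbol" where
  "tape x i = (if i = 0 then Left_End
               else if i \<le> length x then Letter (x ! (i - 1))
               else Right_End)"

definition legal_moves :: "nat \<Rightarrow> 'a tape_symbol list \<Rightarrow> nat list \<Rightarrow> bool" where
  "legal_moves k ss ds \<longleftrightarrow> length ds = k \<and> set ds \<subseteq> {0, 1} \<and>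
     (\<forall>i<k. ss ! i = Right_End \<longrightarrow> ds ! i = 0)"


section \<open>Nondeterministic automata with several one-way heads\<close>

text \<open>A type of states cannot be quantified existentially, so the states of all machines are
  taken, up to renaming, from a finite set of natural numbers; likewise for communication
  symbols further below.\<close>

record 'a nfa =
  nfa_states :: "nat set"
  nfa_init :: nat
  nfa_final :: "nat set"
  nfa_trans :: "nat \<Rightarrow> 'a tape_symbol list \<Rightarrow> (nat \<times> nat list) set"

definition nfa_heads :: "nat \<Rightarrow> 'a nfa \<Rightarrow> bool" where
  "nfa_heads k M \<longleftrightarrow>
     finite (nfa_states M) \<and> nfa_init M \<in> nfa_states M \<and> nfa_final M \<subseteq> nfa_states M \<and>
     (\<forall>q\<in>nfa_states M. \<forall>ss. length ss = k \<longrightarrow>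
        (\<forall>(q', ds)\<in>nfa_trans M q ss. q' \<in> nfa_states M \<and> legal_moves k ss ds))"

definition nfa_step :: "'a nfa \<Rightarrow> 'a list \<Rightarrow> nat \<times> nat list \<Rightarrow> nat \<times> nat list \<Rightarrow> bool" where
  "nfa_step M x = (\<lambda>(q, hs) (q', hs').
     \<exists>ds. (q', ds) \<in> nfa_trans M q (map (tape x) hs) \<and> hs' = map2 (+) hs ds)"

definition nfa_language :: "nat \<Rightarrow> 'a nfa \<Rightarrow> 'a list set" where
  "nfa_language k M =
     {x. \<exists>q\<in>nfa_final M. \<exists>hs. (nfa_step M x)\<^sup>*\<^sup>* (nfa_init M, replicate k 0) (q, hs)}"

definition one_way_NFA :: "nat \<Rightarrow> 'a::finite list set set" where
  "one_way_NFA k = {L. \<exists>M. nfa_heads k M \<and> L = nfa_language k M}"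


section \<open>Verifiers with several one-way heads\<close>

text \<open>Communication cells have type \<^typ>\<open>nat option\<close>, where \<^const>\<open>None\<close> is the null symbol.
  A transition depends on the state, the scanned symbols, the communication cell and, in states
  of \<open>ver_toss\<close>, on the outcome \<open>Some b\<close> of a fresh coin toss; in all other states no coin is
  tossed and the last argument is \<^const>\<open>None\<close>. It yields the next state, the head movements
  and the symbol written in the communication cell.\<close>

record 'a verifier =
  ver_states :: "nat set"
  ver_init :: nat
  ver_acc :: nat
  ver_rej :: nat
  ver_toss :: "nat set"
  ver_comm :: "nat set"
  ver_trans :: "nat \<Rightarrow> 'a tape_symbol list \<Rightarrow> nat option \<Rightarrow> bool option
                  \<Rightarrow> nat \<times> nat list \<times> nat option"

definition comm_symbols :: "'a verifier \<Rightarrow> nat option set" where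
  "comm_symbols V = insert None (Some ` ver_comm V)"

definition verifier_heads :: "nat \<Rightarrow> 'a verifier \<Rightarrow> bool" where
  "verifier_heads k V \<longleftrightarrow>
     finite (ver_states V) \<and> finite (ver_comm V) \<and>
     ver_init V \<in> ver_states V \<and> ver_acc V \<in> ver_states V \<and> ver_rej V \<in> ver_states V \<and>
     ver_acc V \<noteq> ver_rej V \<and> ver_toss V \<subseteq> ver_states V \<and>
     (\<forall>q\<in>ver_states V. \<forall>ss. length ss = k \<longrightarrow> (\<forall>g\<in>comm_symbols V. \<forall>b.
        case ver_trans V q ss g b of (q', ds, w) \<Rightarrow>
          q' \<in> ver_states V \<and> legal_moves k ss ds \<and> w \<in> comm_symbols V))"

text \<open>A prover maps the input, the past exchanges (message of the verifier, reply) and the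
  current non-null message to a reply. Coin tosses and silent steps of the verifier are
  invisible to it. With one-way communication the \<open>i\<close>-th reply depends only on the input
  and \<open>i\<close>.\<close>

type_synonym 'a prover = "'a list \<Rightarrow> (nat \<times> nat option) list \<Rightarrow> nat \<Rightarrow> nat option"

datatype communication = One_Way | Two_Way

definition provers :: "communication \<Rightarrow> 'a verifier \<Rightarrow> 'a prover set" where
  "provers c V = {P. (\<forall>x h m. P x h m \<in> comm_symbols V) \<and>
     (c = One_Way \<longrightarrow> (\<exists>msg. \<forall>x h m. P x h m = msg x (length h)))}"

datatype config = Config (state: nat) (heads: "nat list") (cell: "nat option")
  (history: "(nat \<times> nat option) list") (tosses: nat)

definition ver_step :: "'a verifier \<Rightarrow> 'a prover \<Rightarrow> 'a list \<Rightarrow> (nat \<Rightarrow> bool) \<Rightarrow> config \<Rightarrow> config" where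
  "ver_step V P x \<omega> C =
     (if state C \<in> {ver_acc V, ver_rej V} then C
      else
        let toss = state C \<in> ver_toss V;
            (q, ds, w) = ver_trans V (state C) (map (tape x) (heads C)) (cell C)
                           (if toss then Some (\<omega> (tosses C)) else None);
            hs = map2 (+) (heads C) ds;
            t = (if toss then Suc (tosses C) else tosses C)
        in case w of
             None \<Rightarrow> Config q hs None (history C) t
           | Some m \<Rightarrow> (let a = P x (history C) m
                        in Config q hs a (history C @ [(m, a)]) t))"

definition ver_run :: "nat \<Rightarrow> 'a verifier \<Rightarrow> 'a prover \<Rightarrow> 'a list \<Rightarrow> (nat \<Rightarrow> bool) \<Rightarrow> nat \<Rightarrow> config" where
  "ver_run k V P x \<omega> n =
     (ver_step V P x \<omega> ^^ n) (Config (ver_init V) (replicate k 0) None [] 0)"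

definition coin_space :: "(nat \<Rightarrow> bool) measure" where
  "coin_space = (\<Pi>\<^sub>M i\<in>UNIV. measure_pmf (bernoulli_pmf (1/2)))"

definition accept_prob :: "nat \<Rightarrow> 'a verifier \<Rightarrow> 'a prover \<Rightarrow> 'a list \<Rightarrow> real" where
  "accept_prob k V P x = measure coin_space {\<omega>. \<exists>n. state (ver_run k V P x \<omega> n) = ver_acc V}"

definition reject_prob :: "nat \<Rightarrow> 'a verifier \<Rightarrow> 'a prover \<Rightarrow> 'a list \<Rightarrow> real" where
  "reject_prob k V P x = measure coin_space {\<omega>. \<exists>n. state (ver_run k V P x \<omega> n) = ver_rej V}"


section \<open>Interactive proof systems\<close>

datatype soundness = Strong | Weak

definition proof_system ::
    "soundness \<Rightarrow> communication \<Rightarrow> nat \<Rightarrow> 'a verifier \<Rightarrow> real \<Rightarrow> 'a list set \<Rightarrow> bool" where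
  "proof_system s c k V \<epsilon> L \<longleftrightarrow>
     (\<exists>P\<in>provers c V. \<forall>x\<in>L. accept_prob k V P x \<ge> 1 - \<epsilon>) \<and>
     (\<forall>P\<in>provers c V. \<forall>x. x \<notin> L \<longrightarrow>
        (case s of Strong \<Rightarrow> reject_prob k V P x \<ge> 1 - \<epsilon>
                 | Weak \<Rightarrow> accept_prob k V P x \<le> \<epsilon>))"

definition constant_randomness :: "communication \<Rightarrow> nat \<Rightarrow> 'a verifier \<Rightarrow> bool" where
  "constant_randomness c k V \<longleftrightarrow>
     (\<exists>r. \<forall>P\<in>provers c V. \<forall>x \<omega> n. tosses (ver_run k V P x \<omega> n) \<le> r)"

definition IPS_constant_randomness :: "soundness \<Rightarrow> communication \<Rightarrow> 'a::finite list set set" where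
  "IPS_constant_randomness s c =
     {L. \<exists>k\<ge>1. \<exists>V. verifier_heads k V \<and> constant_randomness c k V \<and>
           (\<exists>\<epsilon>. 0 \<le> \<epsilon> \<and> \<epsilon> < 1/2 \<and> proof_system s c k V \<epsilon> L)}"


section \<open>Measurability of acceptance and rejection\<close>

instance config :: countable
  by countable_datatype

lemma space_coin_space [simp]: "space coin_space = UNIV"
  by (simp add: coin_space_def space_PiM)

lemma measurable_coin: "(\<lambda>\<omega>. \<omega> i) \<in> measurable coin_space (count_space UNIV)"
proof -
  have "(\<lambda>\<omega>. \<omega> i) \<in> measurable coin_space (measure_pmf (bernoulli_pmf (1/2)))"
    unfolding coin_space_def by (rule measurable_component_singleton) simp
  then show ?thesis by simp
qed

lemma measurable_ver_run:
  "(\<lambda>\<omega>. ver_run k V P x \<omega> n) \<in> measurable coin_space (count_space UNIV)"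
proof (induction n)
  case 0
  then show ?case by (simp add: ver_run_def)
next
  case (Suc n)
  have step: "(\<lambda>\<omega>. ver_step V P x \<omega> C) \<in> measurable coin_space (count_space UNIV)" for C
  proof -
    have "ver_step V P x \<omega> C = ver_step V P x (\<lambda>_. \<omega> (tosses C)) C" for \<omega>
      by (simp add: ver_step_def)
    moreover have "(\<lambda>\<omega>. ver_step V P x (\<lambda>_. \<omega> (tosses C)) C)
        \<in> measurable coin_space (count_space UNIV)"
      by (rule measurable_compose[OF measurable_coin]) simp
    ultimately show ?thesis by simp
  qed
  have "(\<lambda>\<omega>. ver_step V P x \<omega> (ver_run k V P x \<omega> n)) \<in> measurable coin_space (count_space UNIV)"
    by (rule measurable_compose_countable[OF step Suc.IH])
  then show ?case by (simp add: ver_run_def)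
qed

lemma sets_ver_run_state:
  "{\<omega>. \<exists>n. state (ver_run k V P x \<omega> n) = q} \<in> sets coin_space"
proof -
  have "{\<omega>. \<exists>n. state (ver_run k V P x \<omega> n) = q} =
      (\<Union>n. (\<lambda>\<omega>. ver_run k V P x \<omega> n) -` {C. state C = q} \<inter> space coin_space)"
    by auto
  also have "\<dots> \<in> sets coin_space"
    by (intro sets.countable_UN image_subsetI measurable_sets[OF measurable_ver_run]) auto
  finally show ?thesis .
qed

end

theory Submission
  imports Defs
begin

text \<open>A nondeterministic automaton is verified without coins: the prover names the transitions of an
  accepting run. Conversely, a verifier that tosses at most \<open>b\<close> coins has at most \<open>2 ^ b\<close> different
  runs against a given prover. Since the strong condition implies the weak one, an input is in the
  language iff some prover makes the runs of more than half of the coin strings accept. A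
  nondeterministic automaton with \<open>k\<close> heads for each coin string guesses such a set of coin strings,
  simulates all their runs in parallel, and guesses the replies of the prover as they are needed. It
  only has to make sure that the replies are consistent: runs in which the prover has seen the same
  messages get the same reply, and with one-way communication all runs do.\<close>

section \<open>Automata with arbitrary finite state sets\<close>

text \<open>One-way heads cannot return to the start of the input, so every coin string needs heads
  of its own and all runs proceed side by side. The obstacle is the memory of the prover: its
  replies may depend on exchanges of unbounded length, which no finite control can store.
  Consistency of guessed replies, however, only requires knowing which of the constantly many runs
  have equal histories, and this relation can be updated from the current messages and replies
  alone, provided that all runs are in the same round. Only accepting runs are guessed; any other
  run might loop silently and block the rounds forever. The threshold one half separates
  \<open>1 - \<epsilon>\<close> from \<open>\<epsilon>\<close> for every admissible error. In the
  direction from automata to verifiers, one deterministic verifier serves all four variants with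
  error 0, because an accepting run is a fixed sequence of replies and the verifier halts against
  every prover of a rejected input.\<close>

definition trans_step ::
    "('q \<Rightarrow> 'a tape_symbol list \<Rightarrow> ('q \<times> nat list) set) \<Rightarrow> 'a list \<Rightarrow>
     'q \<times> nat list \<Rightarrow> 'q \<times> nat list \<Rightarrow> bool" where
  "trans_step T x = (\<lambda>(q, hs) (q', hs').
     \<exists>ds. (q', ds) \<in> T q (map (tape x) hs) \<and> hs' = map2 (+) hs ds)"

lemma map2_add_replicate_0: "length hs = k \<Longrightarrow> map2 (+) hs (replicate k (0::nat)) = hs"
  by (auto intro: nth_equalityI)

lemma sum_list_map2_add:
  "length xs = length ys \<Longrightarrow> sum_list (map2 (+) xs ys) = sum_list xs + (sum_list ys :: nat)"
  by (induction xs ys rule: list_induct2) auto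

lemma legal_moves_replicate_0: "legal_moves k ss (replicate k 0)"
  by (auto simp: legal_moves_def)

text \<open>The joint automaton below has structured states and guesses its coin strings at the
  start, so an arbitrary state type and a set of initial states are allowed here. The states are
  renamed injectively to positive numbers, and 0 becomes a fresh initial state that guesses an
  element of \<open>I\<close> without moving a head.\<close>

lemma nfa_of_transitions:
  fixes S I F :: "'q set" and T :: "'q \<Rightarrow> 'a tape_symbol list \<Rightarrow> ('q \<times> nat list) set"
  assumes S: "finite S" and I: "I \<subseteq> S" and F: "F \<subseteq> S"
    and closed: "\<And>q ss q' ds. q \<in> S \<Longrightarrow> (q', ds) \<in> T q ss \<Longrightarrow> q' \<in> S"
    and legal: "\<And>q ss q' ds. q \<in> S \<Longrightarrow> length ss = k \<Longrightarrow> (q', ds) \<in> T q ss \<Longrightarrow> legal_moves k ss ds"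
  shows "\<exists>M. nfa_heads k M \<and>
    nfa_language k M =
      {x. \<exists>q0\<in>I. \<exists>q\<in>F. \<exists>hs. (trans_step T x)\<^sup>*\<^sup>* (q0, replicate k 0) (q, hs)}"
proof -
  obtain f :: "'q \<Rightarrow> nat" where f: "inj_on f S"
    using finite_imp_inj_to_nat_seg[OF S] by blast
  define M where "M = \<lparr>nfa_states = insert 0 ((\<lambda>q. Suc (f q)) ` S), nfa_init = 0,
    nfa_final = (\<lambda>q. Suc (f q)) ` F,
    nfa_trans = (\<lambda>n ss. if n = 0 then {(Suc (f q), replicate k 0) | q. q \<in> I}
       else {(Suc (f q'), ds) | q q' ds. q \<in> S \<and> n = Suc (f q) \<and> (q', ds) \<in> T q ss})\<rparr>"
  have "nfa_heads k M"
    unfolding nfa_heads_def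
    using S I F closed legal
    by (auto simp: M_def legal_moves_replicate_0 split: if_splits)
  moreover
  have fwd: "(nfa_step M x)\<^sup>*\<^sup>* (Suc (f q), hs) (Suc (f q'), hs')"
    if "(trans_step T x)\<^sup>*\<^sup>* (q, hs) (q', hs')" "q \<in> S" for x q hs q' hs'
    using that
  proof (induction rule: converse_rtranclp_induct2)
    case refl
    then show ?case by simp
  next
    case (step q hs q1 hs1)
    then have "nfa_step M x (Suc (f q), hs) (Suc (f q1), hs1)"
      by (fastforce simp: nfa_step_def trans_step_def M_def)
    moreover have "q1 \<in> S"
      using step closed by (auto simp: trans_step_def)
    ultimately show ?case
      using step by (meson converse_rtranclp_into_rtranclp)
  qed
  have bwd: "\<exists>q'\<in>S. n' = Suc (f q') \<and> (trans_step T x)\<^sup>*\<^sup>* (q, hs) (q', hs')"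
    if "(nfa_step M x)\<^sup>*\<^sup>* (n, hs) (n', hs')" "n = Suc (f q)" "q \<in> S" for x n hs q n' hs'
    using that
  proof (induction arbitrary: q rule: converse_rtranclp_induct2)
    case refl
    then show ?case by auto
  next
    case (step n hs n1 hs1)
    then obtain q2 q1 ds where "q2 \<in> S" "f q = f q2" "(q1, ds) \<in> T q2 (map (tape x) hs)"
        and n1: "n1 = Suc (f q1)" "hs1 = map2 (+) hs ds"
      by (auto simp: nfa_step_def M_def)
    moreover from this step have "q2 = q"
      using f by (auto simp: inj_on_def)
    ultimately have q1: "trans_step T x (q, hs) (q1, hs1)" "n1 = Suc (f q1)" "q1 \<in> S"
      using closed by (auto simp: trans_step_def)
    then show ?case
      using step.IH[OF q1(2,3)] by (meson converse_rtranclp_into_rtranclp)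
  qed
  have "x \<in> nfa_language k M \<longleftrightarrow>
      (\<exists>q0\<in>I. \<exists>q\<in>F. \<exists>hs. (trans_step T x)\<^sup>*\<^sup>* (q0, replicate k 0) (q, hs))" (is "_ \<longleftrightarrow> ?R") for x
  proof
    assume "x \<in> nfa_language k M"
    then obtain n hs where n: "n \<in> nfa_final M"
        and p: "(nfa_step M x)\<^sup>*\<^sup>* (0, replicate k 0) (n, hs)"
      by (auto simp: nfa_language_def M_def)
    \<comment> \<open>The path is not empty: the fresh state 0 is not final.\<close>
    from p n obtain q0 where q0: "q0 \<in> I"
        "(nfa_step M x)\<^sup>*\<^sup>* (Suc (f q0), replicate k 0) (n, hs)"
      by (cases rule: converse_rtranclpE)
        (auto simp: M_def nfa_step_def map2_add_replicate_0)
    obtain q where "q \<in> S" "n = Suc (f q)" "(trans_step T x)\<^sup>*\<^sup>* (q0, replicate k 0) (q, hs)"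
      using bwd[OF q0(2) refl] q0(1) I by auto
    moreover from this n have "q \<in> F"
      using f F by (auto simp: M_def inj_on_def)
    ultimately show ?R using q0 by blast
  next
    assume ?R
    then obtain q0 q hs where q: "q0 \<in> I" "q \<in> F"
        "(trans_step T x)\<^sup>*\<^sup>* (q0, replicate k 0) (q, hs)"
      by blast
    have "nfa_step M x (0, replicate k 0) (Suc (f q0), replicate k 0)"
      using q by (auto simp: nfa_step_def M_def map2_add_replicate_0)
    then have "(nfa_step M x)\<^sup>*\<^sup>* (0, replicate k 0) (Suc (f q), hs)"
      using fwd[OF q(3)] q(1) I by (meson converse_rtranclp_into_rtranclp subsetD)
    then show "x \<in> nfa_language k M"
      using q by (auto simp: nfa_language_def M_def)
  qed
  ultimately show ?thesis by blast
qed


section \<open>Probabilities\<close>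

interpretation coin_space: prob_space coin_space
  unfolding coin_space_def by (intro prob_space_PiM measure_pmf.prob_space_axioms)

definition halted :: "'a verifier \<Rightarrow> config \<Rightarrow> bool" where
  "halted V C \<longleftrightarrow> state C \<in> {ver_acc V, ver_rej V}"

lemma ver_step_halted: "halted V C \<Longrightarrow> ver_step V P x \<omega> C = C"
  by (simp add: ver_step_def halted_def)

lemma funpow_ver_step_halted: "halted V C \<Longrightarrow> (ver_step V P x \<omega> ^^ n) C = C"
  by (induction n) (auto simp: ver_step_halted)

text \<open>Halting configurations are fixed points of \<open>ver_step\<close>, so of two halting
  times the later one shows the same configuration as the earlier one.\<close>

lemma ver_run_halting_state_unique:
  assumes "state (ver_run k V P x \<omega> m) \<in> {ver_acc V, ver_rej V}"
    and "state (ver_run k V P x \<omega> n) \<in> {ver_acc V, ver_rej V}"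
  shows "state (ver_run k V P x \<omega> m) = state (ver_run k V P x \<omega> n)"
proof -
  have *: "ver_run k V P x \<omega> (i + m) = ver_run k V P x \<omega> m"
    if "state (ver_run k V P x \<omega> m) \<in> {ver_acc V, ver_rej V}" for i m
    using funpow_ver_step_halted[of V "ver_run k V P x \<omega> m" i P x \<omega>] that
    unfolding ver_run_def funpow_add by (simp add: halted_def)
  show ?thesis
    using *[OF assms(1), of "n - m"] *[OF assms(2), of "m - n"]
    by (cases "m \<le> n") auto
qed

lemma accept_plus_reject_le_1:
  assumes "ver_acc V \<noteq> ver_rej V"
  shows "accept_prob k V P x + reject_prob k V P x \<le> 1"
proof -
  have "accept_prob k V P x + reject_prob k V P x =
      measure coin_space ({\<omega>. \<exists>n. state (ver_run k V P x \<omega> n) = ver_acc V} \<union>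
        {\<omega>. \<exists>n. state (ver_run k V P x \<omega> n) = ver_rej V})"
    unfolding accept_prob_def reject_prob_def
    by (intro coin_space.finite_measure_Union[symmetric] sets_ver_run_state)
      (use ver_run_halting_state_unique assms in \<open>fastforce\<close>)
  then show ?thesis by simp
qed

text \<open>Acceptance and rejection are disjoint events, so rejection with probability at least
  \<open>1 - \<epsilon>\<close> leaves at most \<open>\<epsilon>\<close> for acceptance.\<close>

lemma strong_proof_system_imp_weak:
  assumes "verifier_heads k V" "proof_system Strong c k V \<epsilon> L"
  shows "proof_system s c k V \<epsilon> L"
proof (cases s)
  case Weak
  have "accept_prob k V P x \<le> \<epsilon>" if "reject_prob k V P x \<ge> 1 - \<epsilon>" for P x
    using accept_plus_reject_le_1[of V k P x] that assms(1) by (auto simp: verifier_heads_def)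
  then show ?thesis
    using assms(2) Weak by (simp add: proof_system_def)
qed (use assms in simp)


section \<open>Verifying nondeterministic automata\<close>

text \<open>Only transitions that move some head are requested from the prover, so that every run halts;
  sequences of stationary transitions are absorbed into the following move.\<close>

definition still_steps :: "nat \<Rightarrow> 'a nfa \<Rightarrow> 'a tape_symbol list \<Rightarrow> nat \<Rightarrow> nat \<Rightarrow> bool" where
  "still_steps k M ss = (\<lambda>q q'. (q', replicate k 0) \<in> nfa_trans M q ss)\<^sup>*\<^sup>*"

definition still_final :: "nat \<Rightarrow> 'a nfa \<Rightarrow> 'a tape_symbol list \<Rightarrow> nat \<Rightarrow> bool" where
  "still_final k M ss q \<longleftrightarrow> (\<exists>q'\<in>nfa_final M. still_steps k M ss q q')"

definition jumps :: "nat \<Rightarrow> 'a nfa \<Rightarrow> nat \<Rightarrow> 'a tape_symbol list \<Rightarrow> (nat \<times> nat list) set" where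
  "jumps k M q ss = {(q', ds). ds \<noteq> replicate k 0 \<and>
     (\<exists>q1. still_steps k M ss q q1 \<and> (q', ds) \<in> nfa_trans M q1 ss)}"

text \<open>State \<open>q\<close> of the automaton becomes \<open>q + 3\<close>; state 2 only sends
  the first request. The message 0 carries no information, it just asks for the next jump, which the
  reply encodes by \<open>to_nat\<close>. Acceptance is tested before the cell is read, so the last
  reply may be anything.\<close>

definition nfa_verifier :: "nat \<Rightarrow> 'a nfa \<Rightarrow> 'a verifier" where
  "nfa_verifier k M = \<lparr>
     ver_states = {0, 1, 2} \<union> (\<lambda>q. q + 3) ` nfa_states M,
     ver_init = 2, ver_acc = 0, ver_rej = 1, ver_toss = {},
     ver_comm = insert 0 (to_nat ` (nfa_states M \<times> {ds. set ds \<subseteq> {0, 1 :: nat} \<and> length ds = k})),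
     ver_trans = (\<lambda>n ss g b.
       if n = 0 \<or> n = 1 then (n, replicate k 0, None)
       else if n = 2 then (nfa_init M + 3, replicate k 0, Some 0)
       else if still_final k M ss (n - 3) then (0, replicate k 0, None)
       else case g of
           None \<Rightarrow> (1, replicate k 0, None)
         | Some m \<Rightarrow>
             if from_nat m \<in> jumps k M (n - 3) ss
             then (fst (from_nat m :: nat \<times> nat list) + 3, snd (from_nat m :: nat \<times> nat list), Some 0)
             else (1, replicate k 0, None))\<rparr>"

lemma nfa_verifier_simps [simp]:
  "ver_init (nfa_verifier k M) = 2" "ver_acc (nfa_verifier k M) = 0"
  "ver_rej (nfa_verifier k M) = 1" "ver_toss (nfa_verifier k M) = {}"
  by (simp_all add: nfa_verifier_def)

context
  fixes k :: nat and M :: "'a nfa"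
  assumes M: "nfa_heads k M"
begin

private abbreviation "V \<equiv> nfa_verifier k M"

lemma nfa_trans_closed:
  assumes "(q', ds) \<in> nfa_trans M q ss" "length ss = k" "q \<in> nfa_states M"
  shows "q' \<in> nfa_states M" "legal_moves k ss ds"
  using assms M unfolding nfa_heads_def by blast+

lemma still_steps_closed:
  assumes "still_steps k M ss q q'" "length ss = k" "q \<in> nfa_states M"
  shows "q' \<in> nfa_states M"
  using assms(1,3) unfolding still_steps_def
  by (induction rule: rtranclp_induct) (use nfa_trans_closed[OF _ assms(2)] in auto)

lemma jumps_closed:
  assumes "(q', ds) \<in> jumps k M q ss" "length ss = k" "q \<in> nfa_states M"
  shows "q' \<in> nfa_states M" "legal_moves k ss ds"
  using assms nfa_trans_closed[OF _ assms(2)] still_steps_closed[OF _ assms(2,3)]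
  by (auto simp: jumps_def)

lemma nfa_verifier_heads: "verifier_heads k V"
proof -
  have "finite {ds. set ds \<subseteq> {0, 1 :: nat} \<and> length ds = k}"
    by (rule finite_lists_length_eq) simp
  then have fin: "finite (ver_states V)" "finite (ver_comm V)"
    using M by (auto simp: nfa_verifier_def nfa_heads_def)
  have "case ver_trans V n ss g b of (q', ds, w) \<Rightarrow>
          q' \<in> ver_states V \<and> legal_moves k ss ds \<and> w \<in> comm_symbols V"
    if n: "n \<in> ver_states V" and ss: "length ss = k" for n ss g b
  proof (cases "n \<le> 2")
    case True
    then show ?thesis
      using M by (auto simp: nfa_verifier_def legal_moves_replicate_0 comm_symbols_def nfa_heads_def)
  next
    case False
    then have q: "n - 3 \<in> nfa_states M"
      using n by (auto simp: nfa_verifier_def)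
    have jump: "fst p \<in> nfa_states M \<and> legal_moves k ss (snd p)" if "p \<in> jumps k M (n - 3) ss" for p
      using that jumps_closed[OF _ ss q, of "fst p" "snd p"] by simp
    show ?thesis
      using False jump
      by (simp add: nfa_verifier_def legal_moves_replicate_0 comm_symbols_def split: option.split)
  qed
  then show ?thesis
    using fin M unfolding verifier_heads_def
    by (auto simp: nfa_heads_def) (auto simp: nfa_verifier_def)
qed

lemma nfa_verifier_no_tosses: "tosses (ver_run k V P x \<omega> n) = 0"
proof (induction n)
  case (Suc n)
  then show ?case
    by (auto simp: ver_run_def ver_step_def Let_def split: option.split prod.split)
qed (simp add: ver_run_def)

lemma still_steps_imp_nfa_step:
  assumes "still_steps k M (map (tape x) hs) q q'" "length hs = k"
  shows "(nfa_step M x)\<^sup>*\<^sup>* (q, hs) (q', hs)"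
  using assms(1) unfolding still_steps_def
proof (induction rule: rtranclp_induct)
  case (step q' q'')
  then have "nfa_step M x (q', hs) (q'', hs)"
    using map2_add_replicate_0[OF assms(2)] by (auto simp: nfa_step_def intro!: exI[of _ "replicate k 0"])
  then show ?case using step by (meson rtranclp.rtrancl_into_rtrancl)
qed simp

lemma jump_imp_nfa_step:
  assumes "(q', ds) \<in> jumps k M q (map (tape x) hs)" "length hs = k"
  shows "(nfa_step M x)\<^sup>*\<^sup>* (q, hs) (q', map2 (+) hs ds)"
proof -
  obtain q1 where q1: "still_steps k M (map (tape x) hs) q q1"
      "(q', ds) \<in> nfa_trans M q1 (map (tape x) hs)"
    using assms by (auto simp: jumps_def)
  have "nfa_step M x (q1, hs) (q', map2 (+) hs ds)"
    using q1 by (auto simp: nfa_step_def)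
  then show ?thesis
    using still_steps_imp_nfa_step[OF q1(1) assms(2)] by (meson rtranclp.rtrancl_into_rtrancl)
qed

text \<open>A stationary first transition is absorbed by the first jump after it, or by
  \<open>still_final\<close> if no jump follows.\<close>

lemma nfa_steps_imp_jumps:
  assumes "(nfa_step M x)\<^sup>*\<^sup>* (q, hs) (qf, hsf)" "qf \<in> nfa_final M"
    and "q \<in> nfa_states M" "length hs = k"
  shows "\<exists>q' hs'. (trans_step (jumps k M) x)\<^sup>*\<^sup>* (q, hs) (q', hs') \<and>
           still_final k M (map (tape x) hs') q'"
  using assms
proof (induction rule: converse_rtranclp_induct2)
  case refl
  then show ?case by (auto simp: still_final_def still_steps_def)
next
  case (step q hs q1 hs1)
  then obtain ds where ds: "(q1, ds) \<in> nfa_trans M q (map (tape x) hs)" "hs1 = map2 (+) hs ds"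
    by (auto simp: nfa_step_def)
  have q1: "q1 \<in> nfa_states M" "length hs1 = k"
    using nfa_trans_closed[OF ds(1)] ds(2) step.prems by (auto simp: legal_moves_def)
  obtain q' hs' where path: "(trans_step (jumps k M) x)\<^sup>*\<^sup>* (q1, hs1) (q', hs')"
      "still_final k M (map (tape x) hs') q'"
    using step q1 by blast
  show ?case
  proof (cases "ds = replicate k 0")
    case False
    then have "(q1, ds) \<in> jumps k M q (map (tape x) hs)"
      using ds by (auto simp: jumps_def still_steps_def)
    then have "trans_step (jumps k M) x (q, hs) (q1, hs1)"
      using ds by (auto simp: trans_step_def)
    then show ?thesis
      using path by (meson converse_rtranclp_into_rtranclp)
  next
    case True
    then have hs1: "hs1 = hs"
      using ds step.prems by (simp add: map2_add_replicate_0)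
    have still: "still_steps k M (map (tape x) hs) q q2" if "still_steps k M (map (tape x) hs) q1 q2" for q2
      using that ds True unfolding still_steps_def
      by (simp add: converse_rtranclp_into_rtranclp)
    from path(1) show ?thesis
    proof (cases rule: converse_rtranclpE)
      case base
      then have "still_final k M (map (tape x) hs) q"
        using path(2) still hs1 by (auto simp: still_final_def)
      then show ?thesis by blast
    next
      case (step qh)
      obtain q2 hs2 where qh: "qh = (q2, hs2)" by force
      have "trans_step (jumps k M) x (q, hs) (q2, hs2)"
        using step(1) still hs1 qh by (auto simp: trans_step_def jumps_def; blast)
      then show ?thesis
        using step(2) path(2) qh by (meson converse_rtranclp_into_rtranclp)
    qed
  qed
qed

lemma nfa_verifier_step_final:
  assumes "state C = q + 3" "still_final k M (map (tape x) (heads C)) q"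
  shows "state (ver_step V P x \<omega> C) = 0"
  using assms by (simp add: ver_step_def) (simp add: nfa_verifier_def)

lemma nfa_verifier_step_jump:
  assumes "state C = q + 3" "\<not> still_final k M (map (tape x) (heads C)) q"
    and "cell C = Some m" "from_nat m = (q', ds)" "(q', ds) \<in> jumps k M q (map (tape x) (heads C))"
  shows "ver_step V P x \<omega> C = Config (q' + 3) (map2 (+) (heads C) ds) (P x (history C) 0)
    (history C @ [(0, P x (history C) 0)]) (tosses C)"
  using assms by (simp add: ver_step_def) (simp add: nfa_verifier_def Let_def)

lemma nfa_verifier_step_reject:
  assumes "state C = q + 3" "\<not> still_final k M (map (tape x) (heads C)) q"
    and "\<And>m. cell C = Some m \<Longrightarrow> from_nat m \<notin> jumps k M q (map (tape x) (heads C))"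
  shows "state (ver_step V P x \<omega> C) = 1"
  using assms by (simp add: ver_step_def) (simp add: nfa_verifier_def split: option.split)

lemma nfa_verifier_run_Suc:
  "ver_run k V P x \<omega> (Suc n) = (ver_step V P x \<omega> ^^ n)
     (Config (nfa_init M + 3) (replicate k 0) (P x [] 0) [(0, P x [] 0)] 0)"
proof -
  have "ver_step V P x \<omega> (Config 2 (replicate k 0) None [] 0) =
      Config (nfa_init M + 3) (replicate k 0) (P x [] 0) [(0, P x [] 0)] 0"
    by (simp add: ver_step_def) (simp add: nfa_verifier_def map2_add_replicate_0 Let_def)
  then show ?thesis
    unfolding ver_run_def funpow_Suc_right by simp
qed

text \<open>The replies are a sequence \<open>f\<close> indexed by the number of exchanges, so they
  also suit one-way communication. \<open>f 0\<close> is already in the cell; the exchanges after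
  the current history of length \<open>l\<close> receive \<open>f 1\<close>, \<open>f 2\<close> and
  so on.\<close>

lemma nfa_verifier_complete:
  assumes "(trans_step (jumps k M) x)\<^sup>*\<^sup>* (q, hs) (qf, hsf)"
    and "still_final k M (map (tape x) hsf) qf"
    and "q \<in> nfa_states M" "length hs = k"
  shows "\<exists>f. range f \<subseteq> comm_symbols V \<and>
    (\<forall>P \<omega> C l. state C = q + 3 \<longrightarrow> heads C = hs \<longrightarrow> cell C = f 0 \<longrightarrow> length (history C) = l \<longrightarrow>
       (\<forall>h m. l \<le> length h \<longrightarrow> P x h m = f (Suc (length h - l))) \<longrightarrow>
       (\<exists>n. state ((ver_step V P x \<omega> ^^ n) C) = 0))"
  using assms
proof (induction rule: converse_rtranclp_induct2)
  case refl
  have "\<exists>n. state ((ver_step V P x \<omega> ^^ n) C) = 0"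
    if "state C = qf + 3" "heads C = hsf" for P \<omega> C
    using nfa_verifier_step_final[of C qf x P \<omega>] that refl(1)
    by (intro exI[of _ "Suc 0"]) simp
  then show ?case
    by (intro exI[of _ "\<lambda>_. None"]) (simp add: comm_symbols_def)
next
  case (step q hs q1 hs1)
  then obtain ds where ds: "(q1, ds) \<in> jumps k M q (map (tape x) hs)" "hs1 = map2 (+) hs ds"
    by (auto simp: trans_step_def)
  have q1: "q1 \<in> nfa_states M" and legal: "legal_moves k (map (tape x) hs) ds"
    using jumps_closed[OF ds(1)] step.prems by auto
  have "length hs1 = k"
    using ds legal step.prems by (simp add: legal_moves_def)
  with step q1 obtain f where f: "range f \<subseteq> comm_symbols V"
    and acc: "\<And>P \<omega> C l. state C = q1 + 3 \<Longrightarrow> heads C = hs1 \<Longrightarrow> cell C = f 0 \<Longrightarrow>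
      length (history C) = l \<Longrightarrow> (\<And>h m. l \<le> length h \<Longrightarrow> P x h m = f (Suc (length h - l))) \<Longrightarrow>
      \<exists>n. state ((ver_step V P x \<omega> ^^ n) C) = 0"
    by blast
  define f' where "f' = case_nat (Some (to_nat (q1, ds))) f"
  have "Some (to_nat (q1, ds)) \<in> comm_symbols V"
    using q1 legal by (auto simp: comm_symbols_def nfa_verifier_def legal_moves_def)
  then have "f' i \<in> comm_symbols V" for i
    using f by (cases i) (auto simp: f'_def)
  then have "range f' \<subseteq> comm_symbols V" by blast
  moreover have "\<exists>n. state ((ver_step V P x \<omega> ^^ n) C) = 0"
    if C: "state C = q + 3" "heads C = hs" "cell C = f' 0"
      and P: "\<And>h m. length (history C) \<le> length h \<Longrightarrow> P x h m = f' (Suc (length h - length (history C)))"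
    for P \<omega> C
  \<comment> \<open>The verifier may accept before the given path is used up.\<close>
  proof (cases "still_final k M (map (tape x) hs) q")
    case True
    then show ?thesis
      using C by (intro exI[of _ "Suc 0"]) (simp add: nfa_verifier_step_final)
  next
    case False
    let ?C = "ver_step V P x \<omega> C"
    have "cell C = Some (to_nat (q1, ds))"
      using C by (simp add: f'_def)
    then have C': "?C = Config (q1 + 3) hs1 (P x (history C) 0) (history C @ [(0, P x (history C) 0)]) (tosses C)"
      using nfa_verifier_step_jump[of C q x "to_nat (q1, ds)" q1 ds P \<omega>] False C ds by simp
    have "\<exists>n. state ((ver_step V P x \<omega> ^^ n) ?C) = 0"
    proof (rule acc)
      show "cell ?C = f 0"
        using P[of "history C" 0] by (simp add: C' f'_def)
      show "P x h m = f (Suc (length h - length (history ?C)))" if "length (history ?C) \<le> length h" for h m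
        using that P[of h m] by (simp add: C' f'_def Suc_diff_Suc)
    qed (simp_all add: C')
    then obtain n where "state ((ver_step V P x \<omega> ^^ n) ?C) = 0" ..
    then show ?thesis
      by (intro exI[of _ "Suc n"]) (simp only: funpow_Suc_right o_apply)
  qed
  ultimately show ?case by blast
qed

text \<open>Nothing is assumed about the prover: each reply is either a genuine jump, which extends
  a path of the automaton, or it causes rejection.\<close>

lemma nfa_verifier_sound:
  assumes "state C = q + 3" "q \<in> nfa_states M" "length (heads C) = k"
    and "\<forall>h\<in>set (heads C). h \<le> length x + 1"
  shows "(\<exists>q'\<in>nfa_final M. \<exists>hs. (nfa_step M x)\<^sup>*\<^sup>* (q, heads C) (q', hs)) \<or>
    (\<exists>n. state ((ver_step V P x \<omega> ^^ n) C) = 1)"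
  using assms
\<comment> \<open>The measure is the total distance that the heads can still travel. Every jump
  moves some head, so it decreases.\<close>
proof (induction "k * (length x + 1) - sum_list (heads C)" arbitrary: C q rule: less_induct)
  case less
  let ?ss = "map (tape x) (heads C)" and ?C = "ver_step V P x \<omega> C"
  consider "still_final k M ?ss q"
    | m q' ds where "\<not> still_final k M ?ss q" "cell C = Some m" "from_nat m = (q', ds)" "(q', ds) \<in> jumps k M q ?ss"
    | "\<not> still_final k M ?ss q" "\<And>m. cell C = Some m \<Longrightarrow> from_nat m \<notin> jumps k M q ?ss"
    by (metis surj_pair)
  then show ?case
  proof cases
    case 1
    then show ?thesis
      using still_steps_imp_nfa_step less.prems by (fastforce simp: still_final_def)
  next
    case 3
    then have "state ?C = 1"
      using nfa_verifier_step_reject less.prems by blast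
    then show ?thesis by (intro disjI2 exI[of _ "Suc 0"]) simp
  next
    case 2
    have C': "state ?C = q' + 3" "heads ?C = map2 (+) (heads C) ds"
      using nfa_verifier_step_jump[OF less.prems(1) 2] by simp_all
    have q': "q' \<in> nfa_states M" and legal: "legal_moves k ?ss ds"
      using jumps_closed[OF 2(4)] less.prems by auto
    have len: "length (heads ?C) = k"
      using C' legal less.prems by (simp add: legal_moves_def)
    have bound: "h \<le> length x + 1" if h: "h \<in> set (heads ?C)" for h
    proof -
      obtain i where "i < k" "h = heads ?C ! i"
        using h unfolding in_set_conv_nth len by blast
      moreover have "length ds = k"
        using legal by (simp add: legal_moves_def)
      ultimately have i: "i < k" "h = heads C ! i + ds ! i"
        using C'(2) less.prems(3) by simp_all
      have "ds ! i \<in> {0, 1}" "heads C ! i \<le> length x + 1"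
        using legal i(1) less.prems(3,4) nth_mem[of i ds] nth_mem[of i "heads C"]
        by (auto simp: legal_moves_def simp del: nth_mem)
      moreover have "heads C ! i = length x + 1 \<Longrightarrow> ds ! i = 0"
        using legal i(1) less.prems(3) by (auto simp: legal_moves_def tape_def)
      ultimately show ?thesis using i by force
    qed
    have sum: "sum_list (heads ?C) = sum_list (heads C) + sum_list ds"
      using C'(2) legal less.prems(3) by (simp add: sum_list_map2_add legal_moves_def)
    have "sum_list ds \<noteq> 0"
    proof
      assume "sum_list ds = 0"
      then have "ds = replicate k 0"
        using legal by (intro replicate_eqI) (auto simp: legal_moves_def)
      then show False using 2 by (simp add: jumps_def)
    qed
    moreover have "sum_list (heads ?C) \<le> k * (length x + 1)"
      using sum_list_mono[of "heads ?C" "\<lambda>h. h" "\<lambda>_. length x + 1"] bound len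
      by (simp add: sum_list_triv)
    ultimately have "k * (length x + 1) - sum_list (heads ?C) < k * (length x + 1) - sum_list (heads C)"
      using sum by linarith
    then have "(\<exists>qf\<in>nfa_final M. \<exists>hs. (nfa_step M x)\<^sup>*\<^sup>* (q', heads ?C) (qf, hs)) \<or>
        (\<exists>n. state ((ver_step V P x \<omega> ^^ n) ?C) = 1)"
      using less.hyps[of ?C q'] C' q' len bound by blast
    then show ?thesis
    proof
      assume "\<exists>qf\<in>nfa_final M. \<exists>hs. (nfa_step M x)\<^sup>*\<^sup>* (q', heads ?C) (qf, hs)"
      then show ?thesis
        using jump_imp_nfa_step[OF 2(4)] less.prems C'(2) by (metis rtranclp_trans)
    next
      assume "\<exists>n. state ((ver_step V P x \<omega> ^^ n) ?C) = 1"
      then obtain n where "state ((ver_step V P x \<omega> ^^ n) ?C) = 1" ..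
      then have "state ((ver_step V P x \<omega> ^^ Suc n) C) = 1"
        by (simp only: funpow_Suc_right o_apply)
      then show ?thesis by blast
    qed
  qed
qed

lemma nfa_verifier_proof_system: "proof_system s c k V 0 (nfa_language k M)"
proof (rule strong_proof_system_imp_weak[OF nfa_verifier_heads])
  let ?L = "nfa_language k M"
  have init: "nfa_init M \<in> nfa_states M"
    using M by (simp add: nfa_heads_def)
  have "\<exists>f. range f \<subseteq> comm_symbols V \<and>
    (\<forall>P \<omega>. (\<forall>h m. P x h m = f (length h)) \<longrightarrow> (\<exists>n. state (ver_run k V P x \<omega> n) = 0))"
    if x: "x \<in> ?L" for x
  proof -
    obtain qf hsf where "(trans_step (jumps k M) x)\<^sup>*\<^sup>* (nfa_init M, replicate k 0) (qf, hsf)"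
        "still_final k M (map (tape x) hsf) qf"
      using nfa_steps_imp_jumps[of x "nfa_init M" "replicate k 0"] x init
      by (fastforce simp: nfa_language_def)
    from nfa_verifier_complete[OF this init]
    obtain f where f: "range f \<subseteq> comm_symbols V"
      and acc: "\<And>P \<omega> C l. state C = nfa_init M + 3 \<Longrightarrow> heads C = replicate k 0 \<Longrightarrow> cell C = f 0 \<Longrightarrow>
        length (history C) = l \<Longrightarrow> (\<And>h m. l \<le> length h \<Longrightarrow> P x h m = f (Suc (length h - l))) \<Longrightarrow>
        \<exists>n. state ((ver_step V P x \<omega> ^^ n) C) = 0"
      by auto
    have "\<exists>n. state (ver_run k V P x \<omega> n) = 0" if P: "\<And>h m. P x h m = f (length h)" for P \<omega>
    proof -
      have "\<exists>n. state ((ver_step V P x \<omega> ^^ n)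
          (Config (nfa_init M + 3) (replicate k 0) (P x [] 0) [(0, P x [] 0)] 0)) = 0"
        \<comment> \<open>The first request is already answered by \<open>f 0\<close>, so here
          \<open>l\<close> is 1 and the later replies are \<open>f (length h)\<close>.\<close>
        by (rule acc) (auto simp: P Suc_le_eq)
      then obtain n where "state (ver_run k V P x \<omega> (Suc n)) = 0"
        using nfa_verifier_run_Suc[of P x \<omega>] by auto
      then show ?thesis ..
    qed
    then show ?thesis using f by blast
  qed
  then obtain F where F: "\<And>x. x \<in> ?L \<Longrightarrow> range (F x) \<subseteq> comm_symbols V"
    and acc: "\<And>x P \<omega>. x \<in> ?L \<Longrightarrow> (\<And>h m. P x h m = F x (length h)) \<Longrightarrow>
      \<exists>n. state (ver_run k V P x \<omega> n) = 0"
    by metis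
  \<comment> \<open>A prover serves all inputs at once: the sequences for the words of the language
    are glued together, with the null symbol as default elsewhere.\<close>
  define P :: "'a prover" where "P = (\<lambda>x h m. if x \<in> ?L then F x (length h) else None)"
  have "P \<in> provers c V"
    using F by (auto simp: P_def provers_def comm_symbols_def
        intro!: exI[of _ "\<lambda>x i. if x \<in> ?L then F x i else None"])
  moreover have "accept_prob k V P x = 1" if "x \<in> ?L" for x
  proof -
    have "{\<omega>. \<exists>n. state (ver_run k V P x \<omega> n) = 0} = space coin_space"
      using acc[OF that, of P] that by (auto simp: P_def)
    then show ?thesis
      by (simp only: accept_prob_def nfa_verifier_simps coin_space.prob_space)
  qed
  moreover have "reject_prob k V P x = 1" if "x \<notin> ?L" for P x
  proof -
    have "\<exists>n. state (ver_run k V P x \<omega> n) = 1" for \<omega>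
    proof -
      let ?C = "Config (nfa_init M + 3) (replicate k 0) (P x [] 0) [(0, P x [] 0)] 0"
      have "(\<exists>q'\<in>nfa_final M. \<exists>hs. (nfa_step M x)\<^sup>*\<^sup>* (nfa_init M, heads ?C) (q', hs)) \<or>
          (\<exists>n. state ((ver_step V P x \<omega> ^^ n) ?C) = 1)"
        by (rule nfa_verifier_sound) (auto simp: init)
      then have "\<exists>n. state ((ver_step V P x \<omega> ^^ n) ?C) = 1"
        using that by (auto simp: nfa_language_def)
      then show ?thesis
        unfolding nfa_verifier_run_Suc[symmetric] by blast
    qed
    then have "{\<omega>. \<exists>n. state (ver_run k V P x \<omega> n) = 1} = space coin_space" by auto
    then show ?thesis
      by (simp only: reject_prob_def nfa_verifier_simps coin_space.prob_space)
  qed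
  ultimately show "proof_system Strong c k V 0 ?L"
    unfolding proof_system_def by (metis diff_zero order_refl soundness.case(1))
qed

end

lemma one_way_NFA_subset_IPS:
  assumes "k \<ge> 1"
  shows "one_way_NFA k \<subseteq> IPS_constant_randomness s c"
proof
  fix L :: "'a::finite list set"
  assume "L \<in> one_way_NFA k"
  then obtain M where M: "nfa_heads k M" "L = nfa_language k M"
    by (auto simp: one_way_NFA_def)
  have "constant_randomness c k (nfa_verifier k M)"
    by (auto simp: constant_randomness_def nfa_verifier_no_tosses[OF M(1)])
  then show "L \<in> IPS_constant_randomness s c"
    unfolding IPS_constant_randomness_def
    using assms M(2) nfa_verifier_heads[OF M(1)] nfa_verifier_proof_system[OF M(1), of s c]
    by (auto intro!: exI[of _ k] exI[of _ "nfa_verifier k M"] exI[of _ "0::real"])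
qed


section \<open>Simulating constantly many runs of a verifier\<close>

text \<open>For every coin string, a group of \<open>k\<close> heads follows one run of the verifier. The runs are
  synchronized at their communication steps: runs whose next step is silent advance first, and when
  there is none, the replies to all pending messages are guessed at once. Two runs are in the
  relation \<open>E\<close> if they have exchanged the same messages so far, so that the prover
  cannot tell them apart.\<close>

definition strip :: "config \<Rightarrow> config" where
  "strip C = Config (state C) [] (cell C) [] (tosses C)"

type_synonym action = "nat \<times> nat list \<times> nat option"

definition action :: "'a verifier \<Rightarrow> (nat \<Rightarrow> bool) \<Rightarrow> 'a tape_symbol list \<Rightarrow> config \<Rightarrow> action" where
  "action V \<omega> ss C = ver_trans V (state C) ss (cell C)
     (if state C \<in> ver_toss V then Some (\<omega> (tosses C)) else None)"

abbreviation moves :: "action \<Rightarrow> nat list" where "moves r \<equiv> fst (snd r)"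
abbreviation message :: "action \<Rightarrow> nat option" where "message r \<equiv> snd (snd r)"

text \<open>The reply is an argument, since the automaton guesses it before any prover is fixed. A
  silent step ignores it.\<close>

definition perform :: "'a verifier \<Rightarrow> config \<Rightarrow> action \<Rightarrow> nat option \<Rightarrow> config" where
  "perform V C r a = Config (fst r) (map2 (+) (heads C) (moves r))
     (case message r of None \<Rightarrow> None | Some m \<Rightarrow> a)
     (case message r of None \<Rightarrow> history C | Some m \<Rightarrow> history C @ [(m, a)])
     (if state C \<in> ver_toss V then Suc (tosses C) else tosses C)"

lemma ver_step_eq_perform:
  assumes "\<not> halted V C" and r: "r = action V \<omega> (map (tape x) (heads C)) C"
    and "\<And>m. message r = Some m \<Longrightarrow> P x (history C) m = a"
  shows "ver_step V P x \<omega> C = perform V C r a"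
  using assms(1,3)
  by (cases r) (auto simp: ver_step_def perform_def halted_def action_def r[unfolded action_def, symmetric] Let_def
      split: option.split)

text \<open>Stripped configurations are what the finite control stores: positions are held by the
  heads of the automaton itself, and histories survive only through \<open>E\<close>. Blank fields,
  rather than a new type, let the same functions act on full and on stripped configurations.\<close>

lemma halted_strip [simp]: "halted V (strip C) \<longleftrightarrow> halted V C"
  by (simp add: halted_def strip_def)

lemma action_strip [simp]: "action V \<omega> ss (strip C) = action V \<omega> ss C"
  by (simp add: action_def strip_def)

lemma strip_strip [simp]: "strip (strip C) = strip C"
  by (simp add: strip_def)

lemma strip_perform_strip [simp]: "strip (perform V (strip C) r a) = strip (perform V C r a)"
  by (simp add: perform_def strip_def split: option.split)

section \<open>Groups of heads within the joint head list\<close>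

definition block :: "nat \<Rightarrow> 'b list \<Rightarrow> nat \<Rightarrow> 'b list" where
  "block k ss j = take k (drop (j * k) ss)"

lemma block_concat:
  assumes "\<And>xs. xs \<in> set xss \<Longrightarrow> length xs = k" "j < length xss"
  shows "block k (concat xss) j = xss ! j"
  using assms
proof (induction xss arbitrary: j)
  case (Cons xs xss)
  then show ?case
    by (cases j) (auto simp: block_def)
qed simp

lemma concat_blocks:
  assumes "length ss = n * k"
  shows "concat (map (block k ss) [0..<n]) = ss"
proof -
  have "concat (map (block k ss) [0..<m]) = take (m * k) ss" for m
    by (induction m) (simp_all add: block_def take_add[symmetric] add.commute)
  then show ?thesis using assms by simp
qed

lemma legal_moves_append:
  assumes "legal_moves k s d" "legal_moves l s' d'" "length s = k"
  shows "legal_moves (k + l) (s @ s') (d @ d')"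
  using assms by (auto simp: legal_moves_def nth_append)

lemma legal_moves_concat:
  assumes "\<And>j. j \<in> set js \<Longrightarrow> length (s j) = k \<and> legal_moves k (s j) (d j)"
  shows "legal_moves (length js * k) (concat (map s js)) (concat (map d js))"
  using assms
proof (induction js)
  case (Cons j js)
  then show ?case
    using legal_moves_append[of k "s j" "d j" "length js * k" "concat (map s js)" "concat (map d js)"]
    by simp
qed (simp add: legal_moves_def)

lemma map2_add_concat:
  assumes "\<And>j. j \<in> set js \<Longrightarrow> length (f j) = length (g j)"
  shows "map2 (+) (concat (map f js)) (concat (map g js)) =
    concat (map (\<lambda>j. map2 (+) (f j) (g j)) js)"
  using assms by (induction js) auto

section \<open>One step of the joint simulation\<close>

definition unhalted :: "'a verifier \<Rightarrow> config list \<Rightarrow> nat set" where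
  "unhalted V Cs = {j. j < length Cs \<and> \<not> halted V (Cs ! j)}"

definition silent :: "'a verifier \<Rightarrow> config list \<Rightarrow> (nat \<Rightarrow> action) \<Rightarrow> nat set" where
  "silent V Cs r = {j \<in> unhalted V Cs. message (r j) = None}"

definition advancing :: "'a verifier \<Rightarrow> config list \<Rightarrow> (nat \<Rightarrow> action) \<Rightarrow> nat set" where
  "advancing V Cs r = (if silent V Cs r = {} then unhalted V Cs else silent V Cs r)"

definition next_configs ::
    "'a verifier \<Rightarrow> config list \<Rightarrow> (nat \<Rightarrow> action) \<Rightarrow> (nat \<Rightarrow> nat option) \<Rightarrow> config list" where
  "next_configs V Cs r a =
     map (\<lambda>j. if j \<in> advancing V Cs r then perform V (Cs ! j) (r j) (a j) else Cs ! j) [0..<length Cs]"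

definition next_moves :: "nat \<Rightarrow> 'a verifier \<Rightarrow> config list \<Rightarrow> (nat \<Rightarrow> action) \<Rightarrow> nat list" where
  "next_moves k V Cs r =
     concat (map (\<lambda>j. if j \<in> advancing V Cs r then moves (r j) else replicate k 0) [0..<length Cs])"

text \<open>A silent step changes no history. In a communication step every unhalted history gains
  one entry, so two of them agree afterwards iff they agreed before and the new entries are equal.
  Pairs with halted runs carry no information.\<close>

definition next_rel ::
    "'a verifier \<Rightarrow> config list \<Rightarrow> (nat \<Rightarrow> action) \<Rightarrow> (nat \<Rightarrow> nat option) \<Rightarrow> nat rel \<Rightarrow> nat rel" where
  "next_rel V Cs r a E =
     (if silent V Cs r = {} then {(i, j) \<in> E. message (r i) = message (r j) \<and> a i = a j} else E)"

text \<open>With one-way communication a reply depends only on the round, and all unhalted runs are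
  in the same round; hence all replies must then be equal.\<close>

definition coherent ::
    "communication \<Rightarrow> 'a verifier \<Rightarrow> config list \<Rightarrow> nat rel \<Rightarrow> (nat \<Rightarrow> action) \<Rightarrow> (nat \<Rightarrow> nat option) \<Rightarrow> bool" where
  "coherent c V Cs E r a \<longleftrightarrow> range a \<subseteq> comm_symbols V \<and>
     (silent V Cs r = {} \<longrightarrow> (\<forall>i\<in>unhalted V Cs. \<forall>j\<in>unhalted V Cs.
        c = One_Way \<or> (i, j) \<in> E \<and> message (r i) = message (r j) \<longrightarrow> a i = a j))"

text \<open>Out of range, \<open>Cs ! j\<close> is unspecified and could differ for \<open>Cs\<close> and \<open>map strip Cs\<close>;
  hence the fixed default value.\<close>

definition actions ::
    "'a verifier \<Rightarrow> (nat \<Rightarrow> bool) list \<Rightarrow> config list \<Rightarrow> (nat \<Rightarrow> 'a tape_symbol list) \<Rightarrow> nat \<Rightarrow> action" where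
  "actions V ws Cs ss = (\<lambda>j. if j < length Cs then action V (ws ! j) (ss j) (Cs ! j) else (0, [], None))"

type_synonym joint_state = "(nat \<Rightarrow> bool) list \<times> config list \<times> nat rel"

text \<open>The coin strings \<open>ws\<close> are fixed by the choice of the initial state.
  Membership in \<open>S\<close> is demanded so that the state set is closed: from unreachable joint
  states the toss counters could exceed their bound.\<close>

definition joint_trans :: "communication \<Rightarrow> nat \<Rightarrow> 'a verifier \<Rightarrow> joint_state set \<Rightarrow>
    joint_state \<Rightarrow> 'a tape_symbol list \<Rightarrow> (joint_state \<times> nat list) set" where
  "joint_trans c k V S = (\<lambda>(ws, Cs, E) ss. let r = actions V ws Cs (block k ss) in
     {((ws, map strip (next_configs V Cs r a), next_rel V Cs r a E), next_moves k V Cs r) | a.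
        coherent c V Cs E r a \<and> (ws, map strip (next_configs V Cs r a), next_rel V Cs r a E) \<in> S})"

lemma length_next_configs [simp]: "length (next_configs V Cs r a) = length Cs"
  by (simp add: next_configs_def)

lemma nth_next_configs:
  "j < length Cs \<Longrightarrow> next_configs V Cs r a ! j =
     (if j \<in> advancing V Cs r then perform V (Cs ! j) (r j) (a j) else Cs ! j)"
  by (simp add: next_configs_def)

lemma advancing_subset: "advancing V Cs r \<subseteq> unhalted V Cs"
  by (auto simp: advancing_def silent_def)

lemma unhalted_strip [simp]: "unhalted V (map strip Cs) = unhalted V Cs"
  by (auto simp: unhalted_def)

lemma silent_strip [simp]: "silent V (map strip Cs) = silent V Cs"
  by (simp add: silent_def fun_eq_iff)

lemma advancing_strip [simp]: "advancing V (map strip Cs) = advancing V Cs"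
  by (simp add: advancing_def fun_eq_iff)

lemma next_configs_strip [simp]:
  "map strip (next_configs V (map strip Cs) r a) = map strip (next_configs V Cs r a)"
  by (auto intro!: nth_equalityI simp: nth_next_configs)

lemma next_moves_strip [simp]: "next_moves k V (map strip Cs) = next_moves k V Cs"
  by (simp add: next_moves_def fun_eq_iff)

lemma next_rel_strip [simp]: "next_rel V (map strip Cs) = next_rel V Cs"
  by (simp add: next_rel_def fun_eq_iff)

lemma coherent_strip [simp]: "coherent c V (map strip Cs) = coherent c V Cs"
  by (simp add: coherent_def fun_eq_iff)

lemma actions_strip [simp]: "actions V ws (map strip Cs) = actions V ws Cs"
  by (simp add: actions_def fun_eq_iff)

abbreviation scanned :: "'a list \<Rightarrow> config list \<Rightarrow> nat \<Rightarrow> 'a tape_symbol list" where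
  "scanned x Ds j \<equiv> map (tape x) (heads (Ds ! j))"

lemma actions_block:
  assumes "\<And>D. D \<in> set Ds \<Longrightarrow> length (heads D) = k"
  shows "actions V ws Ds (block k (map (tape x) (concat (map heads Ds)))) = actions V ws Ds (scanned x Ds)"
proof -
  have "block k (map (tape x) (concat (map heads Ds))) j = scanned x Ds j" if "j < length Ds" for j
    using block_concat[of "map (map (tape x) \<circ> heads) Ds" k j] assms that
    by (simp add: map_concat) fastforce
  then show ?thesis by (auto simp: actions_def)
qed

section \<open>Full configurations behind a joint state\<close>

definition valid :: "nat \<Rightarrow> 'a verifier \<Rightarrow> config \<Rightarrow> bool" where
  "valid k V D \<longleftrightarrow> state D \<in> ver_states V \<and> cell D \<in> comm_symbols V \<and> length (heads D) = k"

text \<open>Here \<open>n\<close> is the number of communication rounds so far. Halted runs are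
  exempt, because their histories stop growing and fall behind.\<close>

definition represents :: "nat \<Rightarrow> 'a verifier \<Rightarrow> nat rel \<Rightarrow> nat \<Rightarrow> config list \<Rightarrow> bool" where
  "represents k V E n Ds \<longleftrightarrow> (\<forall>D\<in>set Ds. valid k V D) \<and>
     (\<forall>j\<in>unhalted V Ds. length (history (Ds ! j)) = n) \<and>
     (\<forall>i\<in>unhalted V Ds. \<forall>j\<in>unhalted V Ds. (i, j) \<in> E \<longleftrightarrow> history (Ds ! i) = history (Ds ! j))"

lemma action_closed:
  assumes "verifier_heads k V" "state C \<in> ver_states V" "cell C \<in> comm_symbols V" "length ss = k"
  shows "fst (action V \<omega> ss C) \<in> ver_states V" "legal_moves k ss (moves (action V \<omega> ss C))"
    "message (action V \<omega> ss C) \<in> comm_symbols V"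
proof -
  have "case action V \<omega> ss C of (q', ds, w) \<Rightarrow>
      q' \<in> ver_states V \<and> legal_moves k ss ds \<and> w \<in> comm_symbols V"
    using assms unfolding verifier_heads_def action_def by simp
  then show "fst (action V \<omega> ss C) \<in> ver_states V" "legal_moves k ss (moves (action V \<omega> ss C))"
    "message (action V \<omega> ss C) \<in> comm_symbols V"
    by (simp_all add: case_prod_unfold)
qed

context
  fixes c :: communication and k :: nat and V :: "'a verifier"
  assumes V: "verifier_heads k V"
begin

lemma valid_perform:
  assumes "valid k V D" "a \<in> comm_symbols V"
  shows "valid k V (perform V D (action V \<omega> (map (tape x) (heads D)) D) a)"
  using action_closed[OF V, of D "map (tape x) (heads D)" \<omega>] assms
  by (auto simp: valid_def perform_def legal_moves_def comm_symbols_def split: option.split)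

lemma valid_next_configs:
  assumes "\<forall>D\<in>set Ds. valid k V D" "range a \<subseteq> comm_symbols V"
  shows "\<forall>D\<in>set (next_configs V Ds (actions V ws Ds (scanned x Ds)) a). valid k V D"
proof -
  have "valid k V (perform V (Ds ! j) (action V (ws ! j) (scanned x Ds j) (Ds ! j)) (a j))"
    if "j < length Ds" for j
    using assms that by (intro valid_perform) auto
  then show ?thesis
    using assms(1) by (auto simp: next_configs_def actions_def)
qed

lemma represents_next:
  assumes rep: "represents k V E n Ds" and a: "range a \<subseteq> comm_symbols V"
    and r: "r = actions V ws Ds (scanned x Ds)"
  shows "represents k V (next_rel V Ds r a E) (if silent V Ds r = {} then Suc n else n)
    (next_configs V Ds r a)"
proof -
  let ?Ds = "next_configs V Ds r a"
  have sub: "j \<in> unhalted V Ds" if "j \<in> unhalted V ?Ds" for j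
    using that advancing_subset[of V Ds r] by (auto simp: unhalted_def nth_next_configs split: if_splits)
  have hist: "history (?Ds ! j) = (if silent V Ds r = {}
      then history (Ds ! j) @ [(the (message (r j)), a j)] else history (Ds ! j))"
    if "j \<in> unhalted V ?Ds" for j
    using sub[OF that]
    by (auto simp: nth_next_configs advancing_def silent_def perform_def unhalted_def split: option.split)
  have msg: "message (r j) \<noteq> None" if "j \<in> unhalted V ?Ds" "silent V Ds r = {}" for j
    using sub[OF that(1)] that(2) by (auto simp: silent_def)
  have "\<forall>D\<in>set ?Ds. valid k V D"
    using valid_next_configs rep a unfolding r represents_def by blast
  moreover have "(i, j) \<in> next_rel V Ds r a E \<longleftrightarrow> history (?Ds ! i) = history (?Ds ! j)"
    if "i \<in> unhalted V ?Ds" "j \<in> unhalted V ?Ds" for i j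
  proof -
    \<comment> \<open>In a communication step both messages are non-null, so \<open>the\<close>
      loses nothing.\<close>
    have "message (r i) = message (r j) \<longleftrightarrow> the (message (r i)) = the (message (r j))"
      if "silent V Ds r = {}"
      using msg[OF \<open>i \<in> unhalted V ?Ds\<close> that] msg[OF \<open>j \<in> unhalted V ?Ds\<close> that] by auto
    then show ?thesis
      using rep sub[OF that(1)] sub[OF that(2)] hist[OF that(1)] hist[OF that(2)]
      by (auto simp: represents_def next_rel_def)
  qed
  moreover have "length (history (?Ds ! j)) = (if silent V Ds r = {} then Suc n else n)"
    if "j \<in> unhalted V ?Ds" for j
    using rep sub[OF that] hist[OF that] by (auto simp: represents_def)
  ultimately show ?thesis by (auto simp: represents_def)
qed

lemma heads_next_configs:
  assumes "\<forall>D\<in>set Ds. valid k V D" and r: "r = actions V ws Ds (scanned x Ds)"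
  shows "map2 (+) (concat (map heads Ds)) (next_moves k V Ds r) = concat (map heads (next_configs V Ds r a))"
proof -
  have valid: "valid k V (Ds ! j)" if "j < length Ds" for j
    using assms that by simp
  have len: "length (heads (Ds ! j)) = k" "length (moves (r j)) = k" if "j < length Ds" for j
    using action_closed(2)[OF V, of "Ds ! j" "scanned x Ds j"] valid[OF that] that
    by (auto simp: r actions_def valid_def legal_moves_def)
  have "concat (map heads Ds) = concat (map (\<lambda>j. heads (Ds ! j)) [0..<length Ds])"
    by (rule arg_cong[of _ _ concat]) (auto intro: nth_equalityI)
  then have "map2 (+) (concat (map heads Ds)) (next_moves k V Ds r) =
    concat (map (\<lambda>j. map2 (+) (heads (Ds ! j)) (if j \<in> advancing V Ds r then moves (r j) else replicate k 0))
      [0..<length Ds])"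
    unfolding next_moves_def by (simp only:) (rule map2_add_concat, simp add: len)
  also have "\<dots> = concat (map heads (next_configs V Ds r a))"
    by (rule arg_cong[of _ _ concat])
      (auto simp: next_configs_def perform_def map2_add_replicate_0 len)
  finally show ?thesis .
qed

text \<open>This translates between the automaton and full configurations: since steps commute with
  \<open>strip\<close>, a step of the joint automaton is a step of any valid full configurations
  with these stripped forms and head positions, and only the replies \<open>a\<close> are
  free.\<close>

lemma joint_step_iff:
  assumes "\<forall>D\<in>set Ds. valid k V D" and r: "r = actions V ws Ds (scanned x Ds)"
  shows "trans_step (joint_trans c k V S) x ((ws, map strip Ds, E), concat (map heads Ds)) (q', hs') \<longleftrightarrow>
    (\<exists>a. coherent c V Ds E r a \<and> q' = (ws, map strip (next_configs V Ds r a), next_rel V Ds r a E) \<and>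
       q' \<in> S \<and> hs' = concat (map heads (next_configs V Ds r a)))"
proof -
  have r': "actions V ws Ds (block k (map (tape x) (concat (map heads Ds)))) = r"
    unfolding r by (rule actions_block) (use assms(1) in \<open>auto simp: valid_def\<close>)
  show ?thesis
    unfolding trans_step_def joint_trans_def
    by (simp add: Let_def r' heads_next_configs[OF assms, of a for a, symmetric]) blast
qed

lemma legal_moves_joint_trans:
  assumes "((ws', Cs', E'), ds) \<in> joint_trans c k V S (ws, Cs, E) ss" "length ss = length Cs * k"
    and "\<And>C. C \<in> set Cs \<Longrightarrow> state C \<in> ver_states V \<and> cell C \<in> comm_symbols V"
  shows "legal_moves (length Cs * k) ss ds"
proof -
  let ?r = "actions V ws Cs (block k ss)"
  let ?d = "\<lambda>j. if j \<in> advancing V Cs ?r then moves (?r j) else replicate k 0"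
  have len: "length (block k ss j) = k" if "j < length Cs" for j
  proof -
    have "Suc j * k \<le> length Cs * k"
      using that by (intro mult_le_mono1) simp
    then show ?thesis
      using assms(2) by (simp add: block_def)
  qed
  have "legal_moves k (block k ss j) (?d j)" if "j < length Cs" for j
    using action_closed(2)[OF V, of "Cs ! j" "block k ss j"] assms(3)[of "Cs ! j"] len[OF that] that
    by (simp add: legal_moves_replicate_0 actions_def)
  then have "legal_moves (length [0..<length Cs] * k)
      (concat (map (block k ss) [0..<length Cs])) (concat (map ?d [0..<length Cs]))"
    by (intro legal_moves_concat) (simp add: len)
  moreover have "ds = concat (map ?d [0..<length Cs])"
    using assms(1) by (auto simp: joint_trans_def next_moves_def Let_def)
  ultimately show ?thesis
    using concat_blocks[OF assms(2)] by simp
qed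

text \<open>Histories only grow, so an unhalted run with at least \<open>n\<close> exchanges never
  asks about a shorter history, and a halted run asks nothing.\<close>

lemma funpow_ver_step_agree:
  assumes "\<And>h m. n \<le> length h \<Longrightarrow> P x h m = P' x h m"
    and "\<not> halted V D \<Longrightarrow> n \<le> length (history D)"
  shows "(ver_step V P x \<omega> ^^ t) D = (ver_step V P' x \<omega> ^^ t) D"
  using assms(2)
proof (induction t arbitrary: D)
  case (Suc t)
  show ?case
  proof (cases "halted V D")
    case True
    then show ?thesis by (simp add: funpow_ver_step_halted ver_step_halted)
  next
    case False
    let ?r = "action V \<omega> (map (tape x) (heads D)) D"
    let ?D = "perform V D ?r (P x (history D) (the (message ?r)))"
    have "ver_step V P x \<omega> D = ?D" "ver_step V P' x \<omega> D = ?D"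
      using Suc.prems False assms(1) by (auto intro!: ver_step_eq_perform)
    moreover have "n \<le> length (history ?D)"
      using Suc.prems False by (auto simp: perform_def split: option.split)
    ultimately show ?thesis
      using Suc.IH[of ?D] by (simp add: funpow_swap1)
  qed
qed simp

text \<open>The prover is assembled backwards along the accepting path. The replies of the current round
  concern histories of the current length \<open>n\<close>, all later ones concern longer histories.\<close>

lemma joint_path_imp_prover:
  assumes "(trans_step (joint_trans c k V S) x)\<^sup>*\<^sup>* ((ws, Cs, E), hs) ((ws', Cs', E'), hs')"
    and "\<forall>C\<in>set Cs'. state C = ver_acc V"
    and "represents k V E n Ds" "length Ds = length ws" "Cs = map strip Ds" "hs = concat (map heads Ds)"
  shows "\<exists>P\<in>provers c V. \<forall>j<length ws. \<exists>t. state ((ver_step V P x (ws ! j) ^^ t) (Ds ! j)) = ver_acc V"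
  using assms
proof (induction "((ws, Cs, E), hs)" arbitrary: Cs E hs Ds n rule: converse_rtranclp_induct)
  case base
  have "(\<lambda>_ _ _. None) \<in> provers c V"
    by (auto simp: provers_def comm_symbols_def)
  moreover have "state (Ds ! j) = ver_acc V" if "j < length ws" for j
    using base that by (auto simp: strip_def)
  ultimately show ?case
    by (intro bexI[of _ "\<lambda>_ _ _. None"] allI impI exI[of _ 0]) auto
next
  case (step q1)
  define r where "r = actions V ws Ds (scanned x Ds)"
  have valid: "\<forall>D\<in>set Ds. valid k V D"
    using step.prems by (simp add: represents_def)
  obtain a where a: "coherent c V Ds E r a"
    and q1: "q1 = ((ws, map strip (next_configs V Ds r a), next_rel V Ds r a E),
      concat (map heads (next_configs V Ds r a)))"
    using step.hyps(1) joint_step_iff[OF valid r_def, of S E] step.prems by (cases q1) auto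
  let ?Ds = "next_configs V Ds r a" and ?n = "if silent V Ds r = {} then Suc n else n"
  have range_a: "range a \<subseteq> comm_symbols V"
    using a by (simp add: coherent_def)
  have rep: "represents k V (next_rel V Ds r a E) ?n ?Ds"
    using represents_next[OF step.prems(2) range_a r_def] .
  obtain P' where P': "P' \<in> provers c V"
    and acc: "\<And>j. j < length ws \<Longrightarrow> \<exists>t. state ((ver_step V P' x (ws ! j) ^^ t) (?Ds ! j)) = ver_acc V"
    using step.hyps(3)[OF q1 step.prems(1) rep] step.prems by auto
  \<comment> \<open>The runs waiting for this reply. With one-way communication every unhalted run
    counts, which makes the choice below independent of \<open>h\<close> and
    \<open>m\<close>.\<close>
  define asks where "asks h m j \<longleftrightarrow> j \<in> unhalted V Ds \<and>
    (c = One_Way \<or> history (Ds ! j) = h \<and> message (r j) = Some m)" for h m j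
  define P where "P = (\<lambda>x h m. if silent V Ds r = {} \<and> length h = n
    then a (SOME j. asks h m j) else P' x h m)"
  have "P \<in> provers c V"
  proof -
    have "P x h m \<in> comm_symbols V" for x h m
      using P' range_a by (auto simp: P_def provers_def)
    moreover have "\<exists>msg. \<forall>x h m. P x h m = msg x (length h)" if c: "c = One_Way"
    proof -
      obtain msg where "\<And>x h m. P' x h m = msg x (length h)"
        using P' c by (auto simp: provers_def)
      then show ?thesis
        by (intro exI[of _ "\<lambda>x l. if silent V Ds r = {} \<and> l = n
              then a (SOME j. j \<in> unhalted V Ds) else msg x l"])
          (auto simp: P_def asks_def[abs_def] c)
    qed
    ultimately show ?thesis by (auto simp: provers_def)
  qed
  moreover have "\<exists>t. state ((ver_step V P x (ws ! j) ^^ t) (Ds ! j)) = ver_acc V" if j: "j < length ws" for j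
  proof -
    obtain t where "state ((ver_step V P' x (ws ! j) ^^ t) (?Ds ! j)) = ver_acc V"
      using acc j by blast
    \<comment> \<open>\<open>P\<close> and \<open>P'\<close> can differ only on histories of length
      \<open>n\<close>, and only if this round communicates; unhalted runs have longer histories
      after it.\<close>
    moreover have "(ver_step V P' x (ws ! j) ^^ t) (?Ds ! j) = (ver_step V P x (ws ! j) ^^ t) (?Ds ! j)"
    proof (rule funpow_ver_step_agree)
      show "P' x h m = P x h m" if "?n \<le> length h" for h m
        using that by (auto simp: P_def)
      show "?n \<le> length (history (?Ds ! j))" if "\<not> halted V (?Ds ! j)"
        using rep j that step.prems by (auto simp: represents_def unhalted_def)
    qed
    ultimately have t: "state ((ver_step V P x (ws ! j) ^^ t) (?Ds ! j)) = ver_acc V" by simp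
    show ?thesis
    proof (cases "j \<in> advancing V Ds r")
      case False
      then show ?thesis
        using t j step.prems by (auto simp: nth_next_configs)
    next
      case True
      then have unh: "j \<in> unhalted V Ds"
        using advancing_subset by blast
      have "P x (history (Ds ! j)) m = a j" if m: "message (r j) = Some m" for m
      proof -
        have sil: "silent V Ds r = {}"
          using True m by (auto simp: advancing_def silent_def split: if_splits)
        have len: "length (history (Ds ! j)) = n"
          using step.prems unh by (auto simp: represents_def)
        \<comment> \<open>By coherence it does not matter which waiting run \<open>SOME\<close>
          selects.\<close>
        have "a i = a j" if i: "asks (history (Ds ! j)) m i" for i
        proof -
          have "i \<in> unhalted V Ds" using i by (simp add: asks_def)
          moreover from this have "c = One_Way \<or> (i, j) \<in> E \<and> message (r i) = message (r j)"
            using i unh m step.prems(2) unfolding asks_def represents_def by metis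
          ultimately show ?thesis
            using a sil unh unfolding coherent_def by blast
        qed
        moreover have "asks (history (Ds ! j)) m (SOME i. asks (history (Ds ! j)) m i)"
          by (rule someI[of _ j]) (use unh m in \<open>auto simp: asks_def\<close>)
        ultimately show ?thesis
          using sil len by (simp add: P_def)
      qed
      then have "ver_step V P x (ws ! j) (Ds ! j) = ?Ds ! j"
        using ver_step_eq_perform[of V "Ds ! j" "r j" "ws ! j" x P "a j"] unh True
        by (simp add: unhalted_def r_def actions_def nth_next_configs)
      then have "state ((ver_step V P x (ws ! j) ^^ Suc t) (Ds ! j)) = ver_acc V"
        using t by (simp only: funpow_Suc_right o_apply)
      then show ?thesis ..
    qed
  qed
  ultimately show ?case by blast
qed

section \<open>From a prover to an accepting joint path\<close>

definition stripped_configs :: "nat \<Rightarrow> config set" where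
  "stripped_configs b = (\<lambda>(q, g, t). Config q [] g [] t) ` (ver_states V \<times> comm_symbols V \<times> {..b})"

definition joint_states :: "nat \<Rightarrow> (nat \<Rightarrow> bool) list set \<Rightarrow> nat \<Rightarrow> joint_state set" where
  "joint_states N W b = W \<times> {Cs. set Cs \<subseteq> stripped_configs b \<and> length Cs = N} \<times> Pow ({..<N} \<times> {..<N})"

lemma finite_joint_states: "finite W \<Longrightarrow> finite (joint_states N W b)"
  using V unfolding joint_states_def stripped_configs_def verifier_heads_def comm_symbols_def
  by (intro finite_cartesian_product finite_lists_length_eq finite_imageI) auto

lemma strip_in_stripped_configs: "valid k V D \<Longrightarrow> tosses D \<le> b \<Longrightarrow> strip D \<in> stripped_configs b"
  by (auto simp: strip_def stripped_configs_def valid_def image_iff)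

text \<open>The automaton guesses the replies that \<open>P\<close> gives on the full histories;
  these are coherent since \<open>E\<close> is equality of histories. The induction is on the total
  number of steps up to the times \<open>t j\<close>: each joint step advances some unhalted run,
  for which \<open>t j\<close> is still positive.\<close>

lemma prover_imp_joint_path:
  assumes P: "P \<in> provers c V" and ws: "ws \<in> W" "length ws = N"
    and "represents k V E n Ds" "length Ds = N" "E \<subseteq> {..<N} \<times> {..<N}"
    and "\<And>j. j < N \<Longrightarrow> state ((ver_step V P x (ws ! j) ^^ t j) (Ds ! j)) = ver_acc V"
    and "\<And>j i. j < N \<Longrightarrow> tosses ((ver_step V P x (ws ! j) ^^ i) (Ds ! j)) \<le> b"
  shows "\<exists>Cs E' hs. (trans_step (joint_trans c k V (joint_states N W b)) x)\<^sup>*\<^sup>*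
      ((ws, map strip Ds, E), concat (map heads Ds)) ((ws, Cs, E'), hs) \<and>
    (ws, Cs, E') \<in> joint_states N W b \<and> (\<forall>C\<in>set Cs. state C = ver_acc V)"
  using assms(4-8)
proof (induction "\<Sum>j<N. t j" arbitrary: E n Ds t rule: less_induct)
  case less
  note prems = less.prems
  have tosses: "tosses D \<le> b" if "D \<in> set Ds" for D
    using prems(5)[of _ 0] that prems(2) by (auto simp: in_set_conv_nth)
  have valid: "\<forall>D\<in>set Ds. valid k V D"
    using prems(1) by (simp add: represents_def)
  have in_S: "(ws, map strip Ds, E) \<in> joint_states N W b"
    using ws prems(2,3) valid tosses strip_in_stripped_configs by (auto simp: joint_states_def)
  show ?case
  proof (cases "\<forall>j<N. state (Ds ! j) = ver_acc V")
    case True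
    then have "\<forall>C\<in>set (map strip Ds). state C = ver_acc V"
      using prems(2) by (auto simp: in_set_conv_nth strip_def)
    then show ?thesis using in_S by blast
  next
    case False
    then obtain j0 where j0: "j0 < N" "state (Ds ! j0) \<noteq> ver_acc V" by blast
    \<comment> \<open>A run halted in another state could not accept at time
      \<open>t j0\<close>.\<close>
    then have "\<not> halted V (Ds ! j0)"
      using prems(4)[OF j0(1)] funpow_ver_step_halted[of V "Ds ! j0"] by auto
    then have "unhalted V Ds \<noteq> {}"
      using j0 prems(2) by (auto simp: unhalted_def)
    define r where "r = actions V ws Ds (scanned x Ds)"
    define a where "a = (\<lambda>j. P x (history (Ds ! j)) (the (message (r j))))"
    let ?Ds = "next_configs V Ds r a" and ?n = "if silent V Ds r = {} then Suc n else n"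
    let ?E = "next_rel V Ds r a E"
    obtain j1 where j1: "j1 \<in> advancing V Ds r"
      using \<open>unhalted V Ds \<noteq> {}\<close> by (cases "silent V Ds r = {}") (auto simp: advancing_def)
    have adv: "j < N" "\<not> halted V (Ds ! j)" if "j \<in> advancing V Ds r" for j
      using that advancing_subset[of V Ds r] prems(2) by (auto simp: unhalted_def)
    have range_a: "range a \<subseteq> comm_symbols V"
      using P by (auto simp: a_def provers_def)
    have "a i = a j" if "i \<in> unhalted V Ds" "j \<in> unhalted V Ds"
        "c = One_Way \<or> (i, j) \<in> E \<and> message (r i) = message (r j)" for i j
    proof (cases "c = One_Way")
      case True
      then obtain msg where "\<And>x h m. P x h m = msg x (length h)"
        using P by (auto simp: provers_def)
      then show ?thesis
        using prems(1) that by (simp add: a_def represents_def)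
    next
      case False
      then show ?thesis
        using prems(1) that by (simp add: a_def represents_def)
    qed
    then have coh: "coherent c V Ds E r a"
      using range_a by (auto simp: coherent_def)
    have rep: "represents k V ?E ?n ?Ds"
      using represents_next[OF prems(1) range_a r_def] .
    have step: "?Ds ! j = (if j \<in> advancing V Ds r then ver_step V P x (ws ! j) (Ds ! j) else Ds ! j)"
      if "j < N" for j
      using adv[of j] that prems(2)
        ver_step_eq_perform[of V "Ds ! j" "r j" "ws ! j" x P "a j"]
      by (auto simp: nth_next_configs a_def r_def actions_def)
    define t' where "t' j = (if j \<in> advancing V Ds r then t j - 1 else t j)" for j
    have t_pos: "t j > 0" if "j \<in> advancing V Ds r" for j
      using prems(4)[of j] adv[OF that] by (cases "t j") (auto simp: halted_def)
    have E: "?E \<subseteq> {..<N} \<times> {..<N}"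
      using prems(3) by (auto simp: next_rel_def)
    have acc': "state ((ver_step V P x (ws ! j) ^^ t' j) (?Ds ! j)) = ver_acc V" if "j < N" for j
    proof (cases "j \<in> advancing V Ds r")
      case True
      then have "t j = Suc (t' j)"
        using t_pos[OF True] by (simp add: t'_def)
      then show ?thesis
        using prems(4)[OF that] step[OF that] True by (simp add: funpow_swap1)
    next
      case False
      then show ?thesis
        using prems(4)[OF that] step[OF that] by (simp add: t'_def)
    qed
    have tosses': "tosses ((ver_step V P x (ws ! j) ^^ i) (?Ds ! j)) \<le> b" if "j < N" for j i
      using prems(5)[OF that, of i] prems(5)[OF that, of "Suc i"] step[OF that]
      by (simp add: funpow_swap1)
    have "(\<Sum>j<N. t' j) < (\<Sum>j<N. t j)"
    proof (rule sum_strict_mono_ex1)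
      show "\<exists>j\<in>{..<N}. t' j < t j"
        using j1 adv[OF j1] t_pos[OF j1] by (intro bexI[of _ j1]) (auto simp: t'_def)
    qed (auto simp: t'_def)
    then obtain Cs E' hs where path: "(trans_step (joint_trans c k V (joint_states N W b)) x)\<^sup>*\<^sup>*
        ((ws, map strip ?Ds, ?E), concat (map heads ?Ds)) ((ws, Cs, E'), hs)"
      and fin: "(ws, Cs, E') \<in> joint_states N W b" "\<forall>C\<in>set Cs. state C = ver_acc V"
      using less.hyps[of t' ?E ?n ?Ds, OF _ rep _ E acc' tosses'] prems(2) by auto
    have "strip D \<in> stripped_configs b" if "D \<in> set ?Ds" for D
      using strip_in_stripped_configs[of D b] rep that tosses'[of _ 0] prems(2)
      by (auto simp: represents_def in_set_conv_nth)
    then have "(ws, map strip ?Ds, ?E) \<in> joint_states N W b"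
      using ws prems(2) E by (auto simp: joint_states_def)
    then have "trans_step (joint_trans c k V (joint_states N W b)) x
        ((ws, map strip Ds, E), concat (map heads Ds)) ((ws, map strip ?Ds, ?E), concat (map heads ?Ds))"
      using joint_step_iff[OF valid r_def] coh by blast
    then show ?thesis
      using path fin by (meson converse_rtranclp_into_rtranclp)
  qed
qed

text \<open>A toss with counter \<open>i\<close> reads the coin \<open>i\<close> and raises the
  counter to \<open>Suc i\<close>, which is at most \<open>b\<close>; so only coins below
  \<open>b\<close> are ever read.\<close>

lemma ver_run_truncate_coins:
  assumes "\<And>n. tosses (ver_run k V P x \<omega> n) \<le> b"
  shows "ver_run k V P x (\<lambda>i. i < b \<and> \<omega> i) n = ver_run k V P x \<omega> n"
proof (induction n)
  case (Suc n)
  let ?C = "ver_run k V P x \<omega> n"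
  have "ver_step V P x (\<lambda>i. i < b \<and> \<omega> i) ?C = ver_step V P x \<omega> ?C"
  proof (cases "state ?C \<in> ver_toss V \<and> \<not> halted V ?C")
    case True
    then have "tosses (ver_run k V P x \<omega> (Suc n)) = Suc (tosses ?C)"
      by (auto simp: ver_run_def ver_step_def Let_def halted_def split: prod.split option.split)
    then have "tosses ?C < b"
      using assms[of "Suc n"] by simp
    then show ?thesis by (simp add: ver_step_def Let_def)
  qed (auto simp: ver_step_def halted_def Let_def)
  then show ?case
    using Suc by (simp add: ver_run_def)
qed (simp add: ver_run_def)

text \<open>On words of the language some prover accepts with probability at least
  \<open>1 - \<epsilon>\<close>, which exceeds one half; on other words every prover stays at or
  below \<open>\<epsilon>\<close>, which is less. So membership means that some list in
  \<open>W\<close> consists of coin strings accepting under a common prover.\<close>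

lemma weak_proof_system_one_way_NFA:
  fixes L :: "'a list set"
  assumes "k \<ge> 1" "constant_randomness c k V" "\<epsilon> < 1/2" and ps: "proof_system Weak c k V \<epsilon> L"
  shows "\<exists>k'\<ge>1. \<exists>M. nfa_heads k' M \<and> L = nfa_language k' M"
proof -
  obtain b where b: "\<And>P x \<omega> n. P \<in> provers c V \<Longrightarrow> tosses (ver_run k V P x \<omega> n) \<le> b"
    using assms(2) unfolding constant_randomness_def by blast
  define trunc :: "(nat \<Rightarrow> bool) \<Rightarrow> nat \<Rightarrow> bool" where "trunc = (\<lambda>\<omega> i. i < b \<and> \<omega> i)"
  have run_trunc: "ver_run k V P x (trunc \<omega>) n = ver_run k V P x \<omega> n" if "P \<in> provers c V" for P x \<omega> n
    unfolding trunc_def by (rule ver_run_truncate_coins) (rule b[OF that])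

  have "range trunc \<subseteq> (\<lambda>X i. i \<in> X) ` Pow {..<b}"
  proof
    fix \<omega>' assume "\<omega>' \<in> range trunc"
    then have "\<omega>' = (\<lambda>i. i \<in> {i. \<omega>' i})" "{i. \<omega>' i} \<in> Pow {..<b}"
      by (auto simp: trunc_def)
    then show "\<omega>' \<in> (\<lambda>X i. i \<in> X) ` Pow {..<b}" by blast
  qed
  then have fin: "finite (range trunc)"
    by (rule finite_subset) auto
  define N where "N = card (range trunc)"
  have N: "N \<ge> 1"
    using fin by (simp add: N_def Suc_le_eq card_gt_0_iff)
  \<comment> \<open>All lists have the same length \<open>N\<close>, so that the number
    \<open>N * k\<close> of heads does not depend on the guess; smaller sets are listed with
    repetitions.\<close>
  define W where "W = {ws. set ws \<subseteq> range trunc \<and> length ws = N \<and>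
    measure coin_space {\<omega>. trunc \<omega> \<in> set ws} > 1/2}"
  have "finite W"
    using finite_lists_length_eq[OF fin, of N] by (rule finite_subset[rotated]) (auto simp: W_def)
  define S where "S = joint_states N W b"
  \<comment> \<open>Initially all histories are empty, hence the full relation.\<close>
  define I :: "joint_state set" where
    "I = (\<lambda>ws. (ws, replicate N (Config (ver_init V) [] None [] 0), {..<N} \<times> {..<N})) ` W"
  define F where "F = {(ws, Cs, E) \<in> S. \<forall>C\<in>set Cs. state C = ver_acc V}"
  define Ds where "Ds = replicate N (Config (ver_init V) (replicate k 0) None [] 0)"
  have strip_Ds: "map strip Ds = replicate N (Config (ver_init V) [] None [] 0)"
    by (simp add: Ds_def strip_def)
  have heads_Ds: "concat (map heads Ds) = replicate (N * k) 0"
    unfolding Ds_def by (induction N) (simp_all add: replicate_add)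
  have run_Ds: "(ver_step V P x \<omega> ^^ n) (Ds ! j) = ver_run k V P x \<omega> n" if "j < N" for P x \<omega> n j
    using that by (simp add: Ds_def ver_run_def)
  have "ver_init V \<in> ver_states V"
    using V by (simp add: verifier_heads_def)
  then have valid_Ds: "\<forall>D\<in>set Ds. valid k V D"
    by (auto simp: Ds_def valid_def comm_symbols_def)
  have rep: "represents k V ({..<N} \<times> {..<N}) 0 Ds"
    using valid_Ds by (auto simp: represents_def unhalted_def Ds_def)
  have "I \<subseteq> S"
    using strip_in_stripped_configs[of "Config (ver_init V) (replicate k 0) None [] 0" b] valid_Ds N
    by (auto simp: I_def S_def joint_states_def Ds_def strip_def)
  have "\<exists>M. nfa_heads (N * k) M \<and> nfa_language (N * k) M =
      {x. \<exists>q0\<in>I. \<exists>q\<in>F. \<exists>hs. (trans_step (joint_trans c k V S) x)\<^sup>*\<^sup>* (q0, replicate (N * k) 0) (q, hs)}"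
  proof (rule nfa_of_transitions[OF _ \<open>I \<subseteq> S\<close>])
    show "finite S"
      unfolding S_def by (rule finite_joint_states) fact
    show "F \<subseteq> S" by (auto simp: F_def)
    show "q' \<in> S" if "(q', ds) \<in> joint_trans c k V S q ss" for q ss q' ds
      using that by (auto simp: joint_trans_def Let_def split: prod.splits)
    show "legal_moves (N * k) ss ds"
      if q: "q \<in> S" "length ss = N * k" "(q', ds) \<in> joint_trans c k V S q ss" for q ss q' ds
    proof -
      obtain ws Cs E where qq: "q = (ws, Cs, E)" by (cases q)
      obtain ws' Cs' E' where q'': "q' = (ws', Cs', E')" by (cases q')
      have Cs: "length Cs = N" "set Cs \<subseteq> stripped_configs b"
        using q(1) by (auto simp: qq S_def joint_states_def)
      then have "state C \<in> ver_states V \<and> cell C \<in> comm_symbols V" if "C \<in> set Cs" for C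
        using that by (auto simp: stripped_configs_def)
      then show ?thesis
        using legal_moves_joint_trans[of ws' Cs' E' ds S ws Cs E ss] q Cs(1) by (simp add: qq q'')
    qed
  qed
  then obtain M where M: "nfa_heads (N * k) M" and lang: "\<And>x. x \<in> nfa_language (N * k) M \<longleftrightarrow>
      (\<exists>q0\<in>I. \<exists>q\<in>F. \<exists>hs. (trans_step (joint_trans c k V S) x)\<^sup>*\<^sup>* (q0, replicate (N * k) 0) (q, hs))"
    by blast
  have "x \<in> nfa_language (N * k) M" if "x \<in> L" for x
  proof -
    obtain P where P: "P \<in> provers c V" "accept_prob k V P x \<ge> 1 - \<epsilon>"
      using ps \<open>x \<in> L\<close> by (auto simp: proof_system_def)
    define A where "A = {\<omega> \<in> range trunc. \<exists>n. state (ver_run k V P x \<omega> n) = ver_acc V}"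
    \<comment> \<open>Truncation does not change a run, so acceptance depends only on the truncated
      coin string.\<close>
    have A: "{\<omega>. \<exists>n. state (ver_run k V P x \<omega> n) = ver_acc V} = {\<omega>. trunc \<omega> \<in> A}"
      by (auto simp: A_def run_trunc[OF P(1)])
    have prob_A: "measure coin_space {\<omega>. trunc \<omega> \<in> A} > 1/2"
      using P(2) \<open>\<epsilon> < 1/2\<close> by (simp add: accept_prob_def A)
    then have "A \<noteq> {}" by auto
    have "finite A"
      using fin by (auto simp: A_def)
    then obtain us where us: "set us = A" "distinct us"
      using finite_distinct_list by blast
    \<comment> \<open>Padding with copies of an accepting coin string is harmless: identical runs
      stay together under the same prover.\<close>
    define ws where "ws = us @ replicate (N - length us) (hd us)"
    have "length us \<le> N"
      using us distinct_card[of us] card_mono[OF fin, of A] by (auto simp: N_def A_def)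
    moreover have "us \<noteq> []"
      using us \<open>A \<noteq> {}\<close> by auto
    ultimately have ws: "set ws = A" "length ws = N"
      using us by (auto simp: ws_def)
    then have W: "ws \<in> W"
      using prob_A by (auto simp: W_def A_def)
    have "\<forall>j. \<exists>t. j < N \<longrightarrow> state (ver_run k V P x (ws ! j) t) = ver_acc V"
      using ws nth_mem[of _ ws] by (fastforce simp: A_def)
    then obtain t where t: "\<And>j. j < N \<Longrightarrow> state (ver_run k V P x (ws ! j) (t j)) = ver_acc V"
      by metis
    have "\<exists>Cs E' hs. (trans_step (joint_trans c k V S) x)\<^sup>*\<^sup>*
        ((ws, map strip Ds, {..<N} \<times> {..<N}), concat (map heads Ds)) ((ws, Cs, E'), hs) \<and>
        (ws, Cs, E') \<in> S \<and> (\<forall>C\<in>set Cs. state C = ver_acc V)"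
      unfolding S_def
    proof (rule prover_imp_joint_path[OF P(1) W ws(2) rep])
      show "length Ds = N" by (simp add: Ds_def)
    qed (use t b[OF P(1)] in \<open>simp_all add: run_Ds\<close>)
    then obtain Cs E' hs where "(trans_step (joint_trans c k V S) x)\<^sup>*\<^sup>*
        ((ws, map strip Ds, {..<N} \<times> {..<N}), concat (map heads Ds)) ((ws, Cs, E'), hs)"
      and "(ws, Cs, E') \<in> F"
      unfolding F_def by blast
    moreover have "(ws, map strip Ds, {..<N} \<times> {..<N}) \<in> I"
      using W by (auto simp: I_def strip_Ds)
    ultimately show ?thesis
      unfolding lang heads_Ds by blast
  qed
  moreover have "x \<in> L" if x: "x \<in> nfa_language (N * k) M" for x
  proof (rule ccontr)
    assume "x \<notin> L"
    obtain ws ws' Cs' E' hs' where ws: "ws \<in> W" and acc: "\<forall>C\<in>set Cs'. state C = ver_acc V"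
      and path: "(trans_step (joint_trans c k V S) x)\<^sup>*\<^sup>*
        ((ws, map strip Ds, {..<N} \<times> {..<N}), concat (map heads Ds)) ((ws', Cs', E'), hs')"
      using x unfolding lang heads_Ds strip_Ds by (auto simp: I_def F_def)
    have len: "length ws = N"
      using ws by (simp add: W_def)
    obtain P where P: "P \<in> provers c V"
      and run: "\<And>j. j < N \<Longrightarrow> \<exists>t. state (ver_run k V P x (ws ! j) t) = ver_acc V"
      using joint_path_imp_prover[OF path acc rep _ refl refl] len run_Ds by (auto simp: Ds_def)
    \<comment> \<open>The assembled prover accepts on every coin sequence that truncates into
      \<open>ws\<close>, an event of probability above one half, against soundness.\<close>
    have "\<exists>t. state (ver_run k V P x \<omega> t) = ver_acc V" if "trunc \<omega> \<in> set ws" for \<omega>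
      using run that len run_trunc[OF P, of x \<omega>] by (metis in_set_conv_nth)
    then have "measure coin_space {\<omega>. trunc \<omega> \<in> set ws} \<le> accept_prob k V P x"
      unfolding accept_prob_def by (intro coin_space.finite_measure_mono sets_ver_run_state) auto
    moreover have "accept_prob k V P x \<le> \<epsilon>"
      using ps P \<open>x \<notin> L\<close> by (simp add: proof_system_def)
    ultimately show False
      using ws \<open>\<epsilon> < 1/2\<close> by (simp add: W_def)
  qed
  ultimately have "L = nfa_language (N * k) M" by blast
  then show ?thesis
    using M N \<open>k \<ge> 1\<close> by (intro exI[of _ "N * k"]) auto
qed

end

lemma IPS_imp_one_way_NFA:
  fixes L :: "'a::finite list set"
  assumes "L \<in> IPS_constant_randomness s c"
  shows "\<exists>k\<ge>1. L \<in> one_way_NFA k"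
proof -
  obtain k V \<epsilon> where k: "k \<ge> 1" and V: "verifier_heads k V" "constant_randomness c k V"
    and \<epsilon>: "\<epsilon> < 1/2" "proof_system s c k V \<epsilon> L"
    using assms by (auto simp: IPS_constant_randomness_def)
  have "proof_system Weak c k V \<epsilon> L"
    using \<epsilon>(2) strong_proof_system_imp_weak[OF V(1)] by (cases s) auto
  then show ?thesis
    using weak_proof_system_one_way_NFA[OF V(1) k V(2) \<epsilon>(1)] by (auto simp: one_way_NFA_def)
qed

theorem theorem8:
  fixes s :: soundness and c :: communication
  shows "(IPS_constant_randomness s c :: 'a::finite list set set) = (\<Union>k\<in>{1..}. one_way_NFA k)"
  using one_way_NFA_subset_IPS IPS_imp_one_way_NFA by fastforce

end
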